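(* The bigraded vector space $\mathfrak{ls}$ of solutions to the linearized double shuffle relations is preserved by the Ihara bracket: $\{\Phi,\Psi\}\in\mathfrak{ls}$ for all $\Phi,\Psi\in\mathfrak{ls}$.
   Context: $\mathcal{U}\mathfrak{g}=\mathbb{Q}\langle e_0,e_1\rangle$ is the free associative algebra (the universal enveloping algebra of the free Lie algebra on $e_0,e_1$). Weight is the length of words; depth ($\mathfrak{D}$-degree) is the number of occurrences of $e_1$. Ihara bracket. Define a bilinear map $\underline{\circ}$ on $\mathcal{U}\mathfrak{g}$, for words $a,w$ and $n\ge0$, by $a\,\underline{\circ}\,e_0^n=e_0^na$ and $a\,\underline{\circ}\,(e_0^ne_1w)=e_0^nae_1w+e_0^ne_1a^*w+e_0^ne_1(a\,\underline{\circ}\,w)$, where $(a_1\cdots a_n)^*=(-1)^na_n\cdots a_1$ for $a_i\in\{e_0,e_1\}$. The Ihara bracket is $\{f,g\}=f\,\underline{\circ}\,g-g\,\underline{\circ}\,f$. Linearized double shuffle relations. Let $Y=\{\mathsf{y}_n:n\ge1\}$ and let $\alpha:\mathbb{Q}\langle e_0,e_1\rangle\to\mathbb{Q}\langle Y\rangle$ be the linear map sending words beginning in $e_0$ to $0$ and $e_1e_0^{a_1}\cdots e_1e_0^{a_r}$ to $\mathsf{y}_{a_1+1}\cdots\mathsf{y}_{a_r+1}$. An element $\Phi\in\mathcal{U}\mathfrak{g}$ homogeneous of weight $N$ and depth $r\ge1$ satisfies the linearized double shuffle relations if: (1) $\Phi$ is primitive for the coproduct on $\mathbb{Q}\langle e_0,e_1\rangle$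 which is a homomorphism for concatenation and for which $e_0,e_1$ are primitive; (2) $\alpha(\Phi)$ is primitive for the coproduct on $\mathbb{Q}\langle Y\rangle$ which is a homomorphism for concatenation and for which all $\mathsf{y}_n$ are primitive; (3) if $r=1$, in addition $\Phi=0$ when $N$ is even and when $N=1$. $\mathfrak{ls}\subset\mathcal{U}\mathfrak{g}$ is the bigraded vector space spanned by all such elements. *)

theory Defs
  imports Complex_Main "HOL-Library.Poly_Mapping" "HOL-Library.Product_Plus"
begin

section \<open>Free associative algebras over the rationals\<close>

text \<open>
  Words over an alphabet form a monoid under concatenation, written additively so that the
  convolution product on finitely supported functions becomes the concatenation product: \<open>'a list
  \<Rightarrow>\<^sub>0 rat\<close> is then the free associative algebra on \<open>'a\<close>. Likewise \<open>'a list \<times> 'a list \<Rightarrow>\<^sub>0 rat\<close>,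
  with basis the pairs of words \<open>u \<otimes> v\<close> and componentwise concatenation, is its tensor square
  with the product \<open>(u \<otimes> v)(u' \<otimes> v') = uu' \<otimes> vv'\<close>.
\<close>

instantiation list :: (type) monoid_add
begin

definition zero_list :: "'a list" where "zero_list = []"
definition plus_list :: "'a list \<Rightarrow> 'a list \<Rightarrow> 'a list" where "plus_list u v = u @ v"

instance by standard (simp_all add: zero_list_def plus_list_def)

end

type_synonym 'a free_alg = "'a list \<Rightarrow>\<^sub>0 rat"
type_synonym 'a free_alg2 = "'a list \<times> 'a list \<Rightarrow>\<^sub>0 rat"

definition smul :: "rat \<Rightarrow> ('k \<Rightarrow>\<^sub>0 rat) \<Rightarrow> ('k \<Rightarrow>\<^sub>0 rat)" where
  "smul c x = Poly_Mapping.map ((*) c) x"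

lemma lookup_smul [simp]: "Poly_Mapping.lookup (smul c x) k = c * Poly_Mapping.lookup x k"
  by (simp add: smul_def Poly_Mapping.map.rep_eq when_def)

interpretation free_module: vector_space smul
  by standard (auto intro!: poly_mapping_eqI simp: lookup_add algebra_simps)

definition word :: "'k \<Rightarrow> ('k \<Rightarrow>\<^sub>0 rat)" where
  "word w = Poly_Mapping.single w 1"

definition lin_ext :: "('k \<Rightarrow> ('l \<Rightarrow>\<^sub>0 rat)) \<Rightarrow> ('k \<Rightarrow>\<^sub>0 rat) \<Rightarrow> ('l \<Rightarrow>\<^sub>0 rat)" where
  "lin_ext f x = (\<Sum>w\<in>Poly_Mapping.keys x. smul (Poly_Mapping.lookup x w) (f w))"

definition tensor :: "'a free_alg \<Rightarrow> 'a free_alg \<Rightarrow> 'a free_alg2" where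
  "tensor x y = lin_ext (\<lambda>u. lin_ext (\<lambda>v. word (u, v)) y) x"

definition coproduct_word :: "'a list \<Rightarrow> 'a free_alg2" where
  "coproduct_word w = prod_list (map (\<lambda>a. tensor (word [a]) 1 + tensor 1 (word [a])) w)"

text \<open>
  The homomorphism for concatenation under which every letter is primitive; see
  \<open>coproduct_add\<close>, \<open>coproduct_smul\<close>, \<open>coproduct_one\<close>, \<open>coproduct_mult\<close> and
  \<open>coproduct_letter\<close> below.
\<close>

definition coproduct :: "'a free_alg \<Rightarrow> 'a free_alg2" where
  "coproduct = lin_ext coproduct_word"

definition primitive :: "'a free_alg \<Rightarrow> bool" where
  "primitive x \<longleftrightarrow> coproduct x = tensor x 1 + tensor 1 x"

lemma lin_ext_superset:
  assumes "finite A" "Poly_Mapping.keys x \<subseteq> A"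
  shows "lin_ext f x = (\<Sum>w\<in>A. smul (Poly_Mapping.lookup x w) (f w))"
  unfolding lin_ext_def using assms
  by (intro sum.mono_neutral_left) (auto simp: in_keys_iff)

lemma lin_ext_add: "lin_ext f (x + y) = lin_ext f x + lin_ext f y"
proof -
  let ?A = "Poly_Mapping.keys x \<union> Poly_Mapping.keys y"
  have "lin_ext f (x + y) = (\<Sum>w\<in>?A. smul (Poly_Mapping.lookup (x + y) w) (f w))"
    by (rule lin_ext_superset) (use Poly_Mapping.keys_add[of x y] in auto)
  also have "\<dots> = (\<Sum>w\<in>?A. smul (Poly_Mapping.lookup x w) (f w))
      + (\<Sum>w\<in>?A. smul (Poly_Mapping.lookup y w) (f w))"
    by (simp add: lookup_add free_module.scale_left_distrib sum.distrib)
  also have "\<dots> = lin_ext f x + lin_ext f y"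
    by (simp add: lin_ext_superset[of ?A])
  finally show ?thesis .
qed

lemma lin_ext_smul: "lin_ext f (smul c x) = smul c (lin_ext f x)"
proof -
  have "lin_ext f (smul c x) =
      (\<Sum>w\<in>Poly_Mapping.keys x. smul (Poly_Mapping.lookup (smul c x) w) (f w))"
    by (rule lin_ext_superset) (auto simp: in_keys_iff)
  then show ?thesis
    by (simp add: lin_ext_def free_module.scale_sum_right)
qed

lemma lin_ext_word [simp]: "lin_ext f (word w) = f w"
  by (simp add: lin_ext_def word_def)

lemma word_mult: "word u * word v = word (u + v)"
  by (simp add: word_def mult_single)

lemma one_eq_word: "(1 :: 'k::monoid_add \<Rightarrow>\<^sub>0 rat) = word 0"
  by (simp add: word_def)

lemma lin_ext_word_self: "lin_ext word x = x"
  by (rule poly_mapping_eqI)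
    (simp add: lin_ext_def lookup_sum word_def lookup_single when_def in_keys_iff
      if_distrib[where f = "(*) _"] sum.delta cong: if_cong)

lemma word_induct [case_names word add smul]:
  assumes word: "\<And>w. P (word w)"
    and add: "\<And>x y. P x \<Longrightarrow> P y \<Longrightarrow> P (x + y)"
    and smul: "\<And>c x. P x \<Longrightarrow> P (smul c x)"
  shows "P (x :: 'k \<Rightarrow>\<^sub>0 rat)"
proof -
  have zero: "P 0" using smul[OF word, of 0 undefined] by simp
  have "P (\<Sum>w\<in>A. smul (Poly_Mapping.lookup x w) (word w))" if "finite A" for A
    using that by (induction A rule: finite_induct) (auto intro: zero word add smul)
  from this[OF finite_keys[of x]] show ?thesis
    using lin_ext_word_self[of x] by (simp add: lin_ext_def)
qed

lemma smul_mult_left: "smul c x * y = smul c (x * y)"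
  for x y :: "'k::monoid_add \<Rightarrow>\<^sub>0 rat"
  by (simp add: smul_def mult_map_scale_conv_mult mult.assoc)

lemma smul_commute_single: "x * Poly_Mapping.single 0 c = Poly_Mapping.single 0 c * x"
  for x :: "'k::monoid_add \<Rightarrow>\<^sub>0 rat"
proof (induction x rule: word_induct)
  case (word w) then show ?case by (simp add: word_def mult_single)
next
  case (add x y) then show ?case by (simp add: algebra_simps)
next
  case (smul d x)
  have "smul d x * Poly_Mapping.single 0 c = smul d (Poly_Mapping.single 0 c * x)"
    using smul by (simp add: smul_mult_left)
  also have "\<dots> = Poly_Mapping.single 0 c * smul d x"
    by (simp add: smul_def mult_map_scale_conv_mult mult_single flip: mult.assoc)
      (simp add: mult.commute)
  finally show ?case .
qed

lemma smul_mult_right: "x * smul c y = smul c (x * y)"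
  for x y :: "'k::monoid_add \<Rightarrow>\<^sub>0 rat"
  by (metis (no_types) smul_def mult_map_scale_conv_mult mult.assoc smul_commute_single)

lemma coproduct_add: "coproduct (x + y) = coproduct x + coproduct y"
  by (simp add: coproduct_def lin_ext_add)

lemma coproduct_smul: "coproduct (smul c x) = smul c (coproduct x)"
  by (simp add: coproduct_def lin_ext_smul)

lemma coproduct_one: "coproduct 1 = 1"
  by (simp add: coproduct_def one_eq_word[where 'k = "'a list"] coproduct_word_def zero_list_def)

lemma coproduct_letter: "primitive (word [a])"
  by (simp add: primitive_def coproduct_def coproduct_word_def)

lemma coproduct_mult: "coproduct (x * y) = coproduct x * coproduct y"
proof (induction x rule: word_induct)
  case (word u)
  show ?case
  proof (induction y rule: word_induct)
    case (word v) then show ?case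
      by (simp add: word_mult coproduct_def coproduct_word_def plus_list_def)
  qed (simp_all add: algebra_simps coproduct_add coproduct_smul smul_mult_right)
qed (simp_all add: algebra_simps coproduct_add coproduct_smul smul_mult_left)


section \<open>The Ihara bracket\<close>

datatype letter = E0 | E1

abbreviation e0 :: "letter free_alg" where "e0 \<equiv> word [E0]"
abbreviation e1 :: "letter free_alg" where "e1 \<equiv> word [E1]"

definition star_word :: "letter list \<Rightarrow> letter free_alg" where
  "star_word a = smul ((-1) ^ length a) (word (rev a))"

lemma letter_word_cases:
  fixes u :: "letter list"
  obtains n where "u = replicate n E0" | n w where "u = replicate n E0 @ E1 # w"
proof -
  have "(\<exists>n. u = replicate n E0) \<or> (\<exists>n w. u = replicate n E0 @ E1 # w)"
  proof (induction u)
    case Nil then show ?case by (auto intro: exI[of _ 0])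
  next
    case (Cons a u) then show ?case
      by (cases a) (metis append_Cons append_Nil replicate_0 replicate_Suc)+
  qed
  then show ?thesis using that by blast
qed

lemma replicate_E0_neq: "replicate m E0 \<noteq> replicate n E0 @ E1 # w"
  by (metis in_set_conv_decomp in_set_replicate letter.distinct(1))

lemma replicate_E0_inj:
  "replicate m E0 @ E1 # v = replicate n E0 @ E1 # w \<Longrightarrow> m = n \<and> v = w"
proof (induction m arbitrary: n)
  case 0 then show ?case by (cases n) auto
next
  case (Suc m) then show ?case by (cases n) auto
qed

function circ_word :: "letter list \<Rightarrow> letter list \<Rightarrow> letter free_alg" where
  "circ_word a (replicate n E0) = e0 ^ n * word a"
| "circ_word a (replicate n E0 @ E1 # w) =
     e0 ^ n * word a * e1 * word w + e0 ^ n * e1 * star_word a * word w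
     + e0 ^ n * e1 * circ_word a w"
proof goal_cases
  case (1 P x) then show ?case
    by (cases x) (metis letter_word_cases)
qed (auto dest: replicate_E0_inj simp: replicate_E0_neq replicate_E0_neq[symmetric])
termination by (relation "measure (\<lambda>(a, u). length u)") auto

definition circ :: "letter free_alg \<Rightarrow> letter free_alg \<Rightarrow> letter free_alg" where
  "circ f g = lin_ext (\<lambda>a. lin_ext (\<lambda>w. circ_word a w) g) f"

definition ihara_bracket :: "letter free_alg \<Rightarrow> letter free_alg \<Rightarrow> letter free_alg" where
  "ihara_bracket f g = circ f g - circ g f"


section \<open>The linearized double shuffle relations\<close>

text \<open>
  The alphabet of letters \<open>y\<^sub>n\<close>, \<open>n \<ge> 1\<close>: the constructor term \<open>Y k\<close> is \<open>y\<^sub>n\<close> for \<open>n = k + 1\<close>.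
\<close>

datatype y_letter = Y nat

definition y_block :: "nat \<Rightarrow> letter list" where
  "y_block k = E1 # replicate k E0"

lemma y_blocks_cases:
  fixes u :: "letter list"
  obtains w where "u = E0 # w" | ks where "u = concat (map y_block ks)"
proof -
  have "\<exists>n ks. u = replicate n E0 @ concat (map y_block ks)"
  proof (induction u)
    case Nil
    have "[] = replicate 0 E0 @ concat (map y_block [])" by simp
    then show ?case by blast
  next
    case (Cons a u)
    then obtain n ks where u: "u = replicate n E0 @ concat (map y_block ks)" by blast
    show ?case
    proof (cases a)
      case E0
      then have "a # u = replicate (Suc n) E0 @ concat (map y_block ks)" using u by simp
      then show ?thesis by blast
    next
      case E1
      then have "a # u = replicate 0 E0 @ concat (map y_block (n # ks))"
        using u by (simp add: y_block_def)
      then show ?thesis by blast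
    qed
  qed
  then obtain n ks where u: "u = replicate n E0 @ concat (map y_block ks)" by blast
  show ?thesis
    by (cases n) (use u that in auto)
qed

lemma concat_y_block_neq: "E0 # w \<noteq> concat (map y_block ks)"
  by (cases ks) (auto simp: y_block_def)

lemma concat_y_block_inj:
  "concat (map y_block ks) = concat (map y_block ls) \<Longrightarrow> ks = ls"
proof (induction ks arbitrary: ls)
  case Nil then show ?case by (cases ls) (auto simp: y_block_def)
next
  case (Cons k ks)
  then obtain l ls' where ls: "ls = l # ls'" by (cases ls) (auto simp: y_block_def)
  have eq: "replicate k E0 @ concat (map y_block ks) = replicate l E0 @ concat (map y_block ls')"
    using Cons.prems unfolding ls by (simp add: y_block_def[of k] y_block_def[of l])
  have tw: "takeWhile ((=) E0) (replicate m E0 @ concat (map y_block ms)) = replicate m E0" for m ms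
    by (induction m) (cases ms; simp add: y_block_def)+
  have "k = l" using arg_cong[OF eq, of "\<lambda>u. length (takeWhile ((=) E0) u)"] by (simp add: tw)
  then show ?case using eq Cons.IH ls by simp
qed

function alpha_word :: "letter list \<Rightarrow> y_letter free_alg" where
  "alpha_word (E0 # w) = 0"
| "alpha_word (concat (map y_block ks)) = word (map Y ks)"
proof goal_cases
  case (1 P x) then show ?case by (metis y_blocks_cases)
qed (auto dest: concat_y_block_inj simp: concat_y_block_neq)
termination by lexicographic_order

definition alpha :: "letter free_alg \<Rightarrow> y_letter free_alg" where
  "alpha = lin_ext alpha_word"

definition bihomogeneous :: "nat \<Rightarrow> nat \<Rightarrow> letter free_alg \<Rightarrow> bool" where
  "bihomogeneous N r \<Phi> \<longleftrightarrow> (\<forall>w\<in>Poly_Mapping.keys \<Phi>. length w = N \<and> count_list w E1 = r)"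

definition linearized_double_shuffle :: "nat \<Rightarrow> nat \<Rightarrow> letter free_alg \<Rightarrow> bool" where
  "linearized_double_shuffle N r \<Phi> \<longleftrightarrow>
     primitive \<Phi> \<and> primitive (alpha \<Phi>) \<and> (r = 1 \<longrightarrow> even N \<or> N = 1 \<longrightarrow> \<Phi> = 0)"

definition ls :: "letter free_alg set" where
  "ls = free_module.span
     {\<Phi>. \<exists>N r. r \<ge> 1 \<and> bihomogeneous N r \<Phi> \<and> linearized_double_shuffle N r \<Phi>}"

end

theory Submission
  imports Defs "HOL-Computational_Algebra.Polynomial"
begin

text \<open>
  The proof is carried out on polynomial functions. The coefficients of the words
  \<open>e0^a0 e1 e0^a1 ... e1 e0^ar\<close> in an element \<open>f\<close> of depth \<open>r\<close> are those of a polynomial in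
  \<open>x0, ..., xr\<close>; its value at a list of rational numbers is \<open>poly_fun f [x0, ..., xr]\<close>, written
  \<open>F(x0, ..., xr)\<close> here. In these terms:

  \<^item> \<open>alpha f\<close> is primitive iff \<open>F(0, x1, ..., xr)\<close> is alternal in \<open>x1, ..., xr\<close>, that is, its sum
    over all shuffles of two nonempty lists vanishes (\<open>primitive_alpha_iff\<close>). The implication from
    right to left uses that a polynomial function determines its coefficients.
  \<^item> If \<open>f\<close> is primitive of depth at least 1, then \<open>F\<close> is translation invariant, so the base point 0
    may be replaced by any other, and the antipode gives
    \<open>F(xr, ..., x0) = (-1)^(N+1) F(x0, ..., xr)\<close>, where \<open>N\<close> is the weight.

  The antipode of the second coalgebra reverses \<open>x1, ..., xr\<close> with the sign \<open>(-1)^(r+1)\<close>. Composing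
  the two reversals gives \<open>F(x0, x1, ..., xr) = (-1)^(N+r) F(x1, ..., xr, x0)\<close>. If \<open>N + r\<close> is odd,
  this says that \<open>F\<close> is anticyclic, and then two shuffle relations with a single letter, based at
  neighbouring points, force \<open>F = 0\<close> when \<open>r\<close> is at least 2; for \<open>r = 1\<close> the parity condition
  in the definition gives the same. So \<open>F\<close> is always cyclically invariant
  (\<open>poly_fun_cyclic\<close>). This is the only place where the condition in depth one enters.

  For primitive \<open>f\<close> the operation \<open>circ f\<close> is a derivation plus right multiplication by \<open>f\<close>. The
  derivation sends \<open>e0\<close> to 0 and \<open>e1\<close> to \<open>[f, e1]\<close>, and a derivation with primitive values on
  letters preserves primitive elements, so the bracket is primitive. On polynomial functions
  \<open>circ f g\<close> with base point \<open>x0\<close> becomes the concatenation product of \<open>F(x0, -)\<close> and \<open>G(x0, -)\<close>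
  plus a sum of terms in which \<open>F(y, b)\<close> multiplies a value of \<open>G\<close>, where \<open>b\<close> is a factor of the
  argument list that follows (positive sign) or precedes (negative sign) the letter \<open>y\<close> and is deleted
  from the argument of \<open>G\<close> (\<open>poly_fun_circ\<close>). A direct computation produces \<open>F(b, y)\<close> in the
  negative terms; cyclic invariance turns it into \<open>F(y, b)\<close>. In this form the
  difference of the positive and negative terms is dual to a derivation of the shuffle algebra, hence
  preserves alternality (\<open>alternal_insertion\<close>); the concatenation products
  contribute a commutator of alternal functions, which is alternal. Therefore
  \<open>alpha\<close> of the bracket is primitive.
\<close>

section \<open>Linear functionals given by functions on words\<close>

definition pairing :: "('k \<Rightarrow> rat) \<Rightarrow> ('k \<Rightarrow>\<^sub>0 rat) \<Rightarrow> rat" where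
  "pairing b x = (\<Sum>w\<in>Poly_Mapping.keys x. Poly_Mapping.lookup x w * b w)"

lemma pairing_superset:
  assumes "finite A" "Poly_Mapping.keys x \<subseteq> A"
  shows "pairing b x = (\<Sum>w\<in>A. Poly_Mapping.lookup x w * b w)"
  unfolding pairing_def using assms
  by (intro sum.mono_neutral_left) (auto simp: in_keys_iff)

lemma pairing_add [simp]: "pairing b (x + y) = pairing b x + pairing b y"
proof -
  let ?A = "Poly_Mapping.keys x \<union> Poly_Mapping.keys y"
  have "pairing b (x + y) = (\<Sum>w\<in>?A. Poly_Mapping.lookup (x + y) w * b w)"
    by (rule pairing_superset) (use Poly_Mapping.keys_add[of x y] in auto)
  then show ?thesis
    by (simp add: pairing_superset[of ?A] lookup_add algebra_simps sum.distrib)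
qed

lemma pairing_smul [simp]: "pairing b (smul c x) = c * pairing b x"
proof -
  have "pairing b (smul c x) = (\<Sum>w\<in>Poly_Mapping.keys x. Poly_Mapping.lookup (smul c x) w * b w)"
    by (rule pairing_superset) (auto simp: in_keys_iff)
  then show ?thesis by (simp add: pairing_def sum_distrib_left mult.assoc)
qed

lemma pairing_word [simp]: "pairing b (word w) = b w"
  by (simp add: pairing_def word_def)

lemma pairing_zero [simp]: "pairing b 0 = 0"
  by (simp add: pairing_def)

lemma pairing_minus [simp]: "pairing b (- x) = - pairing b x"
  using pairing_add[of b x "- x"] by simp

lemma pairing_diff [simp]: "pairing b (x - y) = pairing b x - pairing b y"
  using pairing_add[of b "x - y" y] by simp

lemma pairing_one [simp]: "pairing b (1 :: 'k::monoid_add \<Rightarrow>\<^sub>0 rat) = b 0"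
  by (simp add: one_eq_word)

lemma pairing_lin_ext: "pairing b (lin_ext f x) = pairing (\<lambda>w. pairing b (f w)) x"
  by (induction x rule: word_induct) (simp_all add: lin_ext_add lin_ext_smul)

lemma pairing_add_fun: "pairing (\<lambda>w. b w + b' w) x = pairing b x + pairing b' x"
  by (simp add: pairing_def algebra_simps sum.distrib)

lemma pairing_mult_fun: "pairing (\<lambda>w. c * b w) x = c * pairing b x"
  by (simp add: pairing_def algebra_simps sum_distrib_left)

lemma pairing_zero_fun [simp]: "pairing (\<lambda>w. 0) x = 0"
  by (simp add: pairing_def)

lemma pairing_cong: "(\<And>w. w \<in> Poly_Mapping.keys x \<Longrightarrow> b w = b' w) \<Longrightarrow> pairing b x = pairing b' x"
  by (simp add: pairing_def)

lemma lookup_eq_pairing: "Poly_Mapping.lookup x k = pairing (\<lambda>w. if w = k then 1 else 0) x"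
  by (simp add: pairing_def in_keys_iff if_distrib[where f = "(*) _"] sum.delta cong: if_cong)

lemma pairing_tensor: "pairing B (tensor x y) = pairing (\<lambda>u. pairing (\<lambda>v. B (u, v)) y) x"
  by (simp add: tensor_def pairing_lin_ext)

lemma pairing_tensor_one:
  "pairing B (tensor x 1 + tensor 1 x) = pairing (\<lambda>u. B (u, []) + B ([], u)) x"
  by (simp add: pairing_tensor pairing_add_fun zero_list_def)

section \<open>Primitive elements\<close>

lemma tensor_add_left: "tensor (x + x') y = tensor x y + tensor x' y"
  by (simp add: tensor_def lin_ext_add)

lemma tensor_smul_left: "tensor (smul c x) y = smul c (tensor x y)"
  by (simp add: tensor_def lin_ext_smul)

lemma tensor_word: "tensor (word u) (word v) = word (u, v)"
  by (simp add: tensor_def)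

lemma lin_ext_add_fun: "lin_ext (\<lambda>w. f w + g w) x = lin_ext f x + lin_ext g x"
  by (simp add: lin_ext_def free_module.scale_right_distrib sum.distrib)

lemma lin_ext_smul_fun: "lin_ext (\<lambda>w. smul c (f w)) x = smul c (lin_ext f x)"
  by (simp add: lin_ext_def free_module.scale_sum_right mult.commute)

lemma tensor_add_right: "tensor x (y + y') = tensor x y + tensor x y'"
  by (simp add: tensor_def lin_ext_add lin_ext_add_fun)

lemma tensor_smul_right: "tensor x (smul c y) = smul c (tensor x y)"
  by (simp add: tensor_def lin_ext_smul lin_ext_smul_fun)

lemma tensor_diff_left: "tensor (x - x') y = tensor x y - tensor x' y"
  using tensor_add_left[of "x - x'" x' y] by simp

lemma tensor_diff_right: "tensor y (x - x') = tensor y x - tensor y x'"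
  using tensor_add_right[of y "x - x'" x'] by simp

lemma tensor_zero [simp]: "tensor 0 y = 0" "tensor y 0 = 0"
  using tensor_add_left[of 0 0 y] tensor_add_right[of y 0 0] by simp_all

lemma tensor_mult: "tensor x y * tensor x' y' = tensor (x * x') (y * y')"
proof (induction x rule: word_induct)
  case (word u)
  show ?case
  proof (induction y rule: word_induct)
    case (word v)
    show ?case
    proof (induction x' rule: word_induct)
      case (word u')
      show ?case
        by (induction y' rule: word_induct)
          (simp_all add: word_mult tensor_word tensor_add_right tensor_smul_right
            algebra_simps smul_mult_right)
    qed (simp_all add: tensor_add_left tensor_smul_left algebra_simps smul_mult_right)
  qed (simp_all add: tensor_add_right tensor_smul_right algebra_simps smul_mult_left)
qed (simp_all add: tensor_add_left tensor_smul_left algebra_simps smul_mult_left)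

lemma coproduct_diff: "coproduct (x - y) = coproduct x - coproduct y"
  using coproduct_add[of "x - y" y] by simp

lemma primitive_add: "primitive x \<Longrightarrow> primitive y \<Longrightarrow> primitive (x + y)"
  by (simp add: primitive_def coproduct_add tensor_add_left tensor_add_right)

lemma primitive_diff: "primitive x \<Longrightarrow> primitive y \<Longrightarrow> primitive (x - y)"
  by (simp add: primitive_def coproduct_diff tensor_diff_left tensor_diff_right)

lemma primitive_zero: "primitive 0"
  by (simp add: primitive_def coproduct_def lin_ext_def)

lemma primitive_commutator:
  assumes "primitive x" "primitive y"
  shows "primitive (x * y - y * x)"
  using assms
  by (simp add: primitive_def coproduct_diff coproduct_mult algebra_simps tensor_mult
      tensor_diff_left tensor_diff_right)

lemma coproduct_word_Nil: "coproduct_word [] = word ([], [])"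
  by (simp add: coproduct_word_def one_eq_word zero_prod_def zero_list_def)

lemma coproduct_word_Cons:
  "coproduct_word (a # w) = (tensor (word [a]) 1 + tensor 1 (word [a])) * coproduct_word w"
  by (simp add: coproduct_word_def)

lemma word_one: "1 = word []"
  by (simp add: one_eq_word zero_list_def)

text \<open>
  All evaluations of coproducts below are inductions on words by this rule: the first letter of a word
  goes to one of the two tensor factors.
\<close>

lemma pairing_coproduct_Cons:
  "pairing B (coproduct_word (a # w)) =
     pairing (\<lambda>(u, v). B (a # u, v) + B (u, a # v)) (coproduct_word w)"
proof -
  have "pairing B ((tensor (word [a]) 1 + tensor 1 (word [a])) * X) =
     pairing (\<lambda>(u, v). B (a # u, v) + B (u, a # v)) X" for X
  proof (induction X rule: word_induct)
    case (word w)
    obtain u v where "w = (u, v)" by fastforce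
    then show ?case
      by (simp add: word_one tensor_word algebra_simps word_mult plus_list_def)
  next
    case (smul c X)
    then have "c * pairing B ((tensor (word [a]) 1 + tensor 1 (word [a])) * X) =
        c * pairing (\<lambda>(u, v). B (a # u, v) + B (u, a # v)) X"
      by (rule arg_cong)
    then show ?case by (simp add: algebra_simps smul_mult_right)
  qed (simp add: algebra_simps)
  then show ?thesis by (simp add: coproduct_word_Cons)
qed

lemma pairing_coproduct: "pairing B (coproduct x) = pairing (\<lambda>w. pairing B (coproduct_word w)) x"
  by (simp add: coproduct_def pairing_lin_ext)

lemma pairing_primitive:
  assumes "primitive x"
  shows "pairing (\<lambda>w. pairing B (coproduct_word w)) x = pairing (\<lambda>u. B (u, []) + B ([], u)) x"
  using assms by (simp flip: pairing_coproduct add: primitive_def pairing_tensor_one del: pairing_add)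

fun derivation :: "('a \<Rightarrow> 'a free_alg) \<Rightarrow> 'a list \<Rightarrow> 'a free_alg" where
  "derivation \<delta> [] = 0"
| "derivation \<delta> (a # w) = \<delta> a * word w + word [a] * derivation \<delta> w"

text \<open>
  A derivation \<open>D\<close> with primitive values on letters satisfies \<open>\<Delta> D = (D \<otimes> 1 + 1 \<otimes> D) \<Delta>\<close>,
  because both sides are derivations along \<open>\<Delta>\<close> that agree on letters.
\<close>

lemma coproduct_derivation:
  assumes "\<And>a. primitive (\<delta> a)"
  shows "coproduct (derivation \<delta> w) =
    lin_ext (\<lambda>(u, v). tensor (derivation \<delta> u) (word v) + tensor (word u) (derivation \<delta> v)) (coproduct_word w)"
proof (induction w)
  case Nil
  show ?case by (simp add: coproduct_word_Nil coproduct_def lin_ext_def[of _ 0])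
next
  case (Cons a w)
  let ?L = "lin_ext (\<lambda>(u, v). tensor (derivation \<delta> u) (word v) + tensor (word u) (derivation \<delta> v))"
  have w: "word [a] * word x = word (a # x)" for x
    by (simp add: word_mult plus_list_def)
  have step: "?L ((tensor (word [a]) 1 + tensor 1 (word [a])) * X) =
    (tensor (\<delta> a) 1 + tensor 1 (\<delta> a)) * X + (tensor (word [a]) 1 + tensor 1 (word [a])) * ?L X" for X
  proof (induction X rule: word_induct)
    case (word p)
    obtain u v where p: "p = (u, v)" by fastforce
    have 1: "(tensor (word [a]) 1 + tensor 1 (word [a])) * word p = word (a # u, v) + word (u, a # v)"
      by (simp add: p word_one tensor_word algebra_simps word_mult plus_list_def)
    have 3: "?L (word (u', v')) = tensor (derivation \<delta> u') (word v') + tensor (word u') (derivation \<delta> v')" for u' v'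
      by simp
    show ?case unfolding 1 lin_ext_add unfolding p 3
      by (simp only: tensor_word[symmetric] derivation.simps tensor_add_left tensor_add_right distrib_left distrib_right
          tensor_mult mult_1_left mult_1_right w add_ac)
  next
    case (add X X')
    then show ?case by (simp only: distrib_left lin_ext_add add_ac)
  next
    case (smul c X)
    then show ?case by (simp only: smul_mult_right lin_ext_smul free_module.scale_right_distrib)
  qed
  show ?case
    using assms[of a]
    by (simp add: coproduct_word_Cons step coproduct_add coproduct_mult Cons.IH primitive_def)
      (simp add: coproduct_def coproduct_word_def)
qed

lemma primitive_derivation:
  assumes "\<And>a. primitive (\<delta> a)" "primitive x"
  shows "primitive (lin_ext (derivation \<delta>) x)"
proof -
  let ?L = "lin_ext (\<lambda>(u, v). tensor (derivation \<delta> u) (word v) + tensor (word u) (derivation \<delta> v))"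
  have 1: "coproduct (lin_ext (derivation \<delta>) y) = ?L (coproduct y)" for y
    by (induction y rule: word_induct)
      (simp_all add: lin_ext_add lin_ext_smul coproduct_add coproduct_smul
        coproduct_derivation[OF assms(1)], simp add: coproduct_def)
  have 2: "?L (tensor y 1) = tensor (lin_ext (derivation \<delta>) y) 1"
    "?L (tensor 1 y) = tensor 1 (lin_ext (derivation \<delta>) y)" for y
    by (induction y rule: word_induct)
      (simp_all add: lin_ext_add lin_ext_smul tensor_add_left tensor_add_right
        tensor_smul_left tensor_smul_right word_one tensor_word)
  show ?thesis
    using assms(2) by (simp add: primitive_def 1 2 lin_ext_add)
qed

text \<open>
  The counit applied to both tensor factors of \<open>\<Delta> x = x \<otimes> 1 + 1 \<otimes> x\<close> shows that the constant
  term of \<open>x\<close> equals its own double.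
\<close>

lemma primitive_lookup_Nil:
  assumes "primitive x"
  shows "Poly_Mapping.lookup x [] = 0"
proof -
  let ?B = "\<lambda>(u, v). if u = [] \<and> v = [] then 1 else (0 :: rat)"
  have "pairing ?B (coproduct_word w) = (if w = [] then 1 else 0)" for w :: "'a list"
    by (cases w) (simp_all add: coproduct_word_Nil pairing_coproduct_Cons case_prod_unfold)
  then have "pairing (\<lambda>w. if w = [] then 1 else 0) x =
      pairing (\<lambda>w. (if w = [] then 1 else 0) + (if w = [] then 1 else 0)) x"
    using pairing_primitive[OF assms, of ?B] by simp
  then show ?thesis unfolding pairing_add_fun lookup_eq_pairing by simp
qed

text \<open>
  The antipode acts on primitive elements by \<open>-1\<close>. The antipode identity is obtained by
  pairing \<open>\<Delta> w\<close> with \<open>(-1)^|u| b(rev u @ v)\<close>: the two ways of placing the first letter of a nonempty word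
  cancel.
\<close>

lemma primitive_reversal:
  assumes "primitive x"
  shows "pairing (\<lambda>w. (-1) ^ length w * b (rev w)) x = - pairing b x"
proof -
  let ?B = "\<lambda>(u, v). (-1) ^ length u * b (rev u @ v)"
  have "pairing ?B (coproduct_word w) = b [] * (if w = [] then 1 else 0)" for w
    by (cases w) (simp_all add: coproduct_word_Nil pairing_coproduct_Cons case_prod_unfold)
  then have "b [] * Poly_Mapping.lookup x [] =
      pairing (\<lambda>w. (-1) ^ length w * b (rev w) + b w) x"
    using pairing_primitive[OF assms, of ?B]
    unfolding lookup_eq_pairing pairing_mult_fun[symmetric] by simp
  then show ?thesis
    unfolding pairing_add_fun primitive_lookup_Nil[OF assms] by simp
qed

section \<open>Sums over shuffles and alternal functions\<close>

text \<open>
  The sum of \<open>h\<close> over all shuffles of two lists, counted with multiplicity. Repeated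
  entries matter, since the lists will be arguments of polynomials; this is why no set of shuffles
  is used.
\<close>

fun shuffle_sum :: "('a list \<Rightarrow> rat) \<Rightarrow> 'a list \<Rightarrow> 'a list \<Rightarrow> rat" where
  "shuffle_sum h [] vs = h vs"
| "shuffle_sum h (u # us) [] = h (u # us)"
| "shuffle_sum h (u # us) (v # vs) =
     shuffle_sum (\<lambda>w. h (u # w)) us (v # vs) + shuffle_sum (\<lambda>w. h (v # w)) (u # us) vs"

text \<open>
  The sum of \<open>h b c\<close> over all ways of cutting the list as \<open>b @ c\<close>.
\<close>

fun split_sum :: "('a list \<Rightarrow> 'a list \<Rightarrow> rat) \<Rightarrow> 'a list \<Rightarrow> rat" where
  "split_sum h [] = h [] []"
| "split_sum h (x # w) = h [] (x # w) + split_sum (\<lambda>b. h (x # b)) w"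

text \<open>
  The sum of \<open>h b y c\<close> over all ways of writing the list as \<open>b @ y # c\<close>.
\<close>

fun point_sum :: "('a list \<Rightarrow> 'a \<Rightarrow> 'a list \<Rightarrow> rat) \<Rightarrow> 'a list \<Rightarrow> rat" where
  "point_sum h [] = 0"
| "point_sum h (x # w) = h [] x w + point_sum (\<lambda>b. h (x # b)) w"

lemma shuffle_sum_Nil2 [simp]: "shuffle_sum h us [] = h us"
  by (cases us) simp_all

lemma shuffle_sum_Nil1 [simp]: "shuffle_sum h [] = h"
  by (rule ext) simp

lemma shuffle_sum_add: "shuffle_sum (\<lambda>w. h w + k w) us vs = shuffle_sum h us vs + shuffle_sum k us vs"
  by (induction h us vs arbitrary: k rule: shuffle_sum.induct) simp_all

lemma shuffle_sum_diff: "shuffle_sum (\<lambda>w. h w - k w) us vs = shuffle_sum h us vs - shuffle_sum k us vs"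
  by (induction h us vs arbitrary: k rule: shuffle_sum.induct) simp_all

lemma shuffle_sum_mult: "shuffle_sum (\<lambda>w. c * h w) us vs = c * shuffle_sum h us vs"
  by (induction h us vs rule: shuffle_sum.induct) (simp_all add: algebra_simps)

lemma split_sum_add: "split_sum (\<lambda>b c. h b c + k b c) w = split_sum h w + split_sum k w"
  by (induction w arbitrary: h k) simp_all

lemma split_sum_mult: "split_sum (\<lambda>b c. x * h b c) w = x * split_sum h w"
  by (induction w arbitrary: h) (simp_all add: algebra_simps)

lemma split_sum_zero [simp]: "split_sum (\<lambda>b c. 0) w = 0"
  by (induction w) simp_all

lemma point_sum_add: "point_sum (\<lambda>b y c. h b y c + k b y c) w = point_sum h w + point_sum k w"
  by (induction w arbitrary: h k) simp_all

lemma point_sum_mult: "point_sum (\<lambda>b y c. x * h b y c) w = x * point_sum h w"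
  by (induction w arbitrary: h) (simp_all add: algebra_simps)

lemma point_sum_zero [simp]: "point_sum (\<lambda>b y c. 0) w = 0"
  by (induction w) simp_all

lemma split_sum_left_Nil: "split_sum (\<lambda>b c. if b = [] then h b c else 0) w = h [] w"
  by (cases w) simp_all

lemma split_sum_right_Nil: "split_sum (\<lambda>b c. if c = [] then h b c else 0) w = h w []"
  by (induction w arbitrary: h) simp_all

lemma split_sum_swap:
  "split_sum (\<lambda>a b. split_sum (\<lambda>c d. h a b c d) v) w = split_sum (\<lambda>c d. split_sum (\<lambda>a b. h a b c d) w) v"
  by (induction w arbitrary: h) (simp_all add: split_sum_add)

lemma shuffle_sum_split_sum_out:
  "shuffle_sum (\<lambda>p. split_sum (\<lambda>b c. h p b c) w) us vs = split_sum (\<lambda>b c. shuffle_sum (\<lambda>p. h p b c) us vs) w"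
  by (induction w arbitrary: h) (simp_all add: shuffle_sum_add)

lemma shuffle_induct [case_names Nil1 Nil2 Cons]:
  assumes "\<And>vs. P [] vs" "\<And>u us. P (u # us) []"
    and "\<And>u us v vs. P us (v # vs) \<Longrightarrow> P (u # us) vs \<Longrightarrow> P (u # us) (v # vs)"
  shows "P us vs"
proof (induction us arbitrary: vs)
  case (Cons u us)
  then show ?case by (induction vs) (auto intro: assms)
qed (rule assms)

lemma shuffle_sum_commute: "shuffle_sum h us vs = shuffle_sum h vs us"
  by (induction us vs arbitrary: h rule: shuffle_induct) simp_all

text \<open>
  Compatibility of shuffling with deconcatenation: a cut of a shuffle of \<open>us\<close> and \<open>vs\<close> cuts both
  lists, and its parts are shuffles of the corresponding parts.
\<close>

lemma shuffle_sum_split_sum: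
  "shuffle_sum (split_sum h) us vs =
   split_sum (\<lambda>u1 u2. split_sum (\<lambda>v1 v2. shuffle_sum (\<lambda>p. shuffle_sum (h p) u2 v2) u1 v1) vs) us"
proof (induction us vs arbitrary: h rule: shuffle_induct)
  case (Cons u us v vs)
  show ?case
    by (simp add: shuffle_sum_add split_sum_add Cons.IH)
qed simp_all

text \<open>
  The marked letter of a shuffle comes from one of the two lists and marks that list; the other list is cut
  in two. The second summand is the first one with the two lists exchanged.
\<close>

lemma shuffle_sum_point_sum:
  "shuffle_sum (point_sum h) us vs =
   point_sum (\<lambda>u1 y u2. split_sum (\<lambda>v1 v2. shuffle_sum (\<lambda>p. shuffle_sum (h p y) u2 v2) u1 v1) vs) us
   + point_sum (\<lambda>v1 y v2. split_sum (\<lambda>u1 u2. shuffle_sum (\<lambda>p. shuffle_sum (h p y) v2 u2) v1 u1) us) vs"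
proof -
  have "shuffle_sum (point_sum h) us vs =
    point_sum (\<lambda>u1 y u2. split_sum (\<lambda>v1 v2. shuffle_sum (\<lambda>p. shuffle_sum (h p y) u2 v2) u1 v1) vs) us
    + point_sum (\<lambda>v1 y v2. split_sum (\<lambda>u1 u2. shuffle_sum (\<lambda>p. shuffle_sum (h p y) u2 v2) u1 v1) us) vs"
  proof (induction us vs arbitrary: h rule: shuffle_induct)
    case (Cons u us v vs)
    show ?case
      by (simp add: shuffle_sum_add split_sum_add point_sum_add Cons.IH)
  qed simp_all
  moreover have "(\<lambda>v1 y v2. split_sum (\<lambda>u1 u2. shuffle_sum (\<lambda>p. shuffle_sum (h p y) u2 v2) u1 v1) us) =
      (\<lambda>v1 y v2. split_sum (\<lambda>u1 u2. shuffle_sum (\<lambda>p. shuffle_sum (h p y) v2 u2) v1 u1) us)"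
    by (intro ext arg_cong[where f = "\<lambda>k. split_sum k us"], subst shuffle_sum_commute,
        rule arg_cong[where f = "\<lambda>k. shuffle_sum k _ _"], intro ext, rule shuffle_sum_commute)
  ultimately show ?thesis by (rule back_subst[of "\<lambda>k. _ = _ + point_sum k vs"])
qed

text \<open>
  A letter of the first list cuts every shuffle into a part before and a part after it, and with
  it the second list.
\<close>

lemma shuffle_sum_at_point:
  "shuffle_sum G (u @ y # c) vs =
   split_sum (\<lambda>v1 v2. shuffle_sum (\<lambda>p. shuffle_sum (\<lambda>q. G (p @ y # q)) c v2) u v1) vs"
proof (induction G u vs rule: shuffle_sum.induct)
  case (1 h vs)
  show ?case by (induction vs arbitrary: h) simp_all
next
  case (2 h u us)
  then show ?case by simp
next
  case (3 h u us v vs)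
  then show ?case by (simp add: split_sum_add)
qed

text \<open>
  For two nonempty lists the right-hand side is 0, which is the usual condition. With one empty list
  the equation is trivial, and for two empty lists it says \<open>h [] = 0\<close>. In this uniform version it is
  literally the equation \<open>\<Delta> x = x \<otimes> 1 + 1 \<otimes> x\<close> evaluated on \<open>us\<close> and \<open>vs\<close>.
\<close>

definition alternal :: "('a list \<Rightarrow> rat) \<Rightarrow> bool" where
  "alternal h \<longleftrightarrow> (\<forall>us vs. shuffle_sum h us vs = (if vs = [] then h us else 0) + (if us = [] then h vs else 0))"

lemma shuffle_sum_mult_right: "shuffle_sum (\<lambda>w. h w * c) us vs = shuffle_sum h us vs * c"
  using shuffle_sum_mult[of c h] by (simp add: mult.commute)

lemma shuffle_sum_prod:
  "shuffle_sum (\<lambda>p. shuffle_sum (\<lambda>q. A p * B q) us vs) us' vs' = shuffle_sum A us' vs' * shuffle_sum B us vs"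
  by (simp add: shuffle_sum_mult shuffle_sum_mult_right)

text \<open>
  In a product cut off from a shuffle, an alternal first factor must take its letters from only one
  of the two lists.
\<close>

lemma shuffle_sum_split_left_alternal:
  assumes "alternal A"
  shows "shuffle_sum (\<lambda>w. split_sum (\<lambda>b c. A b * B c) w) us vs =
     split_sum (\<lambda>b c. A b * shuffle_sum B c vs) us + split_sum (\<lambda>b c. A b * shuffle_sum B us c) vs"
proof -
  have *: "shuffle_sum A u1 v1 * X = (if v1 = [] then A u1 * X else 0) + (if u1 = [] then A v1 * X else 0)" for u1 v1 X
    using assms by (simp add: alternal_def algebra_simps)
  have "split_sum (\<lambda>u1 u2. split_sum (\<lambda>v1 v2. if u1 = [] then A v1 * shuffle_sum B u2 v2 else 0) vs) us
     = split_sum (\<lambda>b c. A b * shuffle_sum B us c) vs"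
    by (subst split_sum_swap) (simp add: split_sum_left_Nil)
  then show ?thesis
    by (simp add: shuffle_sum_split_sum shuffle_sum_prod * split_sum_add split_sum_left_Nil)
qed

lemma shuffle_sum_split_right_alternal:
  assumes "alternal A"
  shows "shuffle_sum (\<lambda>w. split_sum (\<lambda>b c. A c * B b) w) us vs =
     split_sum (\<lambda>b c. A c * shuffle_sum B b vs) us + split_sum (\<lambda>b c. A c * shuffle_sum B us b) vs"
proof -
  have *: "X * shuffle_sum A u1 v1 = (if v1 = [] then A u1 * X else 0) + (if u1 = [] then A v1 * X else 0)" for u1 v1 X
    using assms by (simp add: alternal_def algebra_simps)
  have "split_sum (\<lambda>u1 u2. split_sum (\<lambda>v1 v2. if u2 = [] then A v2 * shuffle_sum B u1 v1 else 0) vs) us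
     = split_sum (\<lambda>b c. A c * shuffle_sum B us b) vs"
    by (subst split_sum_swap) (simp add: split_sum_right_Nil)
  then show ?thesis
    by (simp add: shuffle_sum_split_sum shuffle_sum_prod mult.commute[of "A _" "B _"] * split_sum_add split_sum_right_Nil)
qed

section \<open>Inserting and deleting factors next to a letter\<close>

text \<open>
  All ways of writing the argument as \<open>a @ y # b @ c\<close>; the factor \<open>b\<close> after the letter \<open>y\<close> is moved into \<open>f\<close>.
\<close>

definition insert_after :: "('a list \<Rightarrow> rat) \<Rightarrow> ('a list \<Rightarrow> rat) \<Rightarrow> 'a list \<Rightarrow> rat" where
  "insert_after f G = point_sum (\<lambda>a y z. split_sum (\<lambda>b c. f (y # b) * G (a @ y # c)) z)"

text \<open>
  All ways of writing the argument as \<open>a @ b @ y # c\<close>; here the factor \<open>b\<close> precedes the letter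
  \<open>y\<close>, but \<open>f\<close> is still evaluated at \<open>y # b\<close>.
\<close>

definition insert_before :: "('a list \<Rightarrow> rat) \<Rightarrow> ('a list \<Rightarrow> rat) \<Rightarrow> 'a list \<Rightarrow> rat" where
  "insert_before f G = point_sum (\<lambda>z y c. split_sum (\<lambda>a b. f (y # b) * G (a @ y # c)) z)"

text \<open>
  The obstruction to \<open>insert_after f\<close> and \<open>insert_before f\<close> being dual to derivations of the
  shuffle product: the letter \<open>y\<close> comes from \<open>us\<close> and the factor \<open>b\<close> from \<open>vs\<close>. It does
  not record on which side of \<open>y\<close> the factor \<open>b\<close> was, since \<open>b\<close> is deleted from a position
  adjacent to \<open>y\<close>.
\<close>

definition cross_terms :: "('a list \<Rightarrow> rat) \<Rightarrow> ('a list \<Rightarrow> rat) \<Rightarrow> 'a list \<Rightarrow> 'a list \<Rightarrow> rat" where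
  "cross_terms f G us vs = point_sum (\<lambda>a y c. split_sum (\<lambda>a' z. split_sum (\<lambda>b c'.
     f (y # b) * shuffle_sum (\<lambda>p. shuffle_sum (\<lambda>q. G (p @ y # q)) c c') a a') z) vs) us"

lemma split_sum_assoc:
  "split_sum (\<lambda>a z. split_sum (\<lambda>b c. h a b c) z) w = split_sum (\<lambda>z c. split_sum (\<lambda>a b. h a b c) z) w"
  by (induction w arbitrary: h) (simp_all add: split_sum_add)

text \<open>
  By alternality of \<open>f(y, -)\<close> the removed factor \<open>b\<close> lies in one of the lists. If it lies in
  the same list as \<open>y\<close>, removing it commutes with shuffling and gives the first two terms; otherwise
  it contributes a cross term.
\<close>

lemma shuffle_sum_insert_after:
  assumes "\<And>y. alternal (\<lambda>b. f (y # b))"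
  shows "shuffle_sum (insert_after f G) us vs =
    insert_after f (\<lambda>u. shuffle_sum G u vs) us + insert_after f (\<lambda>v. shuffle_sum G v us) vs
    + cross_terms f G us vs + cross_terms f G vs us"
proof -
  let ?S = "\<lambda>y u1 v1 c v2. shuffle_sum (\<lambda>p. shuffle_sum (\<lambda>q. G (p @ y # q)) c v2) u1 v1"
  have *: "split_sum (\<lambda>v1 v2. shuffle_sum (\<lambda>p. shuffle_sum (\<lambda>z. split_sum (\<lambda>b c.
        f (y # b) * G (p @ y # c)) z) u2 v2) u1 v1) vs =
      split_sum (\<lambda>b c. f (y # b) * shuffle_sum G (u1 @ y # c) vs) u2
      + split_sum (\<lambda>a z. split_sum (\<lambda>b c. f (y # b) * ?S y u1 a u2 c) z) vs"
    for y u1 u2 and vs :: "'a list"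
  proof -
    have "split_sum (\<lambda>v1 v2. split_sum (\<lambda>b c. f (y # b) * ?S y u1 v1 c v2) u2) vs =
        split_sum (\<lambda>b c. f (y # b) * shuffle_sum G (u1 @ y # c) vs) u2"
      by (subst split_sum_swap) (simp add: split_sum_mult shuffle_sum_at_point)
    then show ?thesis
      unfolding shuffle_sum_split_left_alternal[OF assms] shuffle_sum_add split_sum_add
        shuffle_sum_split_sum_out shuffle_sum_mult by simp
  qed
  show ?thesis
    unfolding insert_after_def shuffle_sum_point_sum * point_sum_add cross_terms_def
    by (simp only: ac_simps)
qed

text \<open>
  The same argument gives the same cross terms as for \<open>insert_after\<close>, so that they cancel in the difference.
\<close>

lemma shuffle_sum_insert_before:
  assumes "\<And>y. alternal (\<lambda>b. f (y # b))"
  shows "shuffle_sum (insert_before f G) us vs =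
    insert_before f (\<lambda>u. shuffle_sum G u vs) us + insert_before f (\<lambda>v. shuffle_sum G v us) vs
    + cross_terms f G us vs + cross_terms f G vs us"
proof -
  let ?S = "\<lambda>y u1 v1 c v2. shuffle_sum (\<lambda>p. shuffle_sum (\<lambda>q. G (p @ y # q)) c v2) u1 v1"
  have *: "split_sum (\<lambda>v1 v2. shuffle_sum (\<lambda>p. shuffle_sum (\<lambda>q. split_sum (\<lambda>a b.
        f (y # b) * G (a @ y # q)) p) u2 v2) u1 v1) vs =
      split_sum (\<lambda>a b. f (y # b) * shuffle_sum G (a @ y # u2) vs) u1
      + split_sum (\<lambda>a z. split_sum (\<lambda>b c. f (y # b) * ?S y u1 a u2 c) z) vs"
    for y u1 u2 and vs :: "'a list"
  proof -
    have 1: "split_sum (\<lambda>v1 v2. split_sum (\<lambda>a b. f (y # b) * ?S y a v1 u2 v2) u1) vs =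
        split_sum (\<lambda>a b. f (y # b) * shuffle_sum G (a @ y # u2) vs) u1"
      by (subst split_sum_swap) (simp only: split_sum_mult shuffle_sum_at_point)
    have 2: "split_sum (\<lambda>v1 v2. split_sum (\<lambda>a b. f (y # b) * ?S y u1 a u2 v2) v1) vs =
        split_sum (\<lambda>a z. split_sum (\<lambda>b c. f (y # b) * ?S y u1 a u2 c) z) vs"
      by (rule split_sum_assoc[symmetric])
    have 3: "shuffle_sum (\<lambda>p. shuffle_sum (\<lambda>q. split_sum (\<lambda>a b.
        f (y # b) * G (a @ y # q)) p) u2 v2) u1 v1 =
        split_sum (\<lambda>a b. f (y # b) * ?S y a v1 u2 v2) u1
        + split_sum (\<lambda>a b. f (y # b) * ?S y u1 a u2 v2) v1" for v1 v2
      unfolding shuffle_sum_split_sum_out shuffle_sum_mult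
      by (rule shuffle_sum_split_right_alternal[OF assms])
    show ?thesis
      unfolding 3 split_sum_add 1 2 ..
  qed
  show ?thesis
    unfolding insert_before_def shuffle_sum_point_sum * point_sum_add cross_terms_def
    by (simp only: ac_simps)
qed

definition insertion :: "('a list \<Rightarrow> rat) \<Rightarrow> ('a list \<Rightarrow> rat) \<Rightarrow> 'a list \<Rightarrow> rat" where
  "insertion f G w = insert_after f G w - insert_before f G w"

section \<open>Alternality of commutators, and anticyclic functions\<close>

definition concat_product :: "('a list \<Rightarrow> rat) \<Rightarrow> ('a list \<Rightarrow> rat) \<Rightarrow> 'a list \<Rightarrow> rat" where
  "concat_product A B w = split_sum (\<lambda>b c. A b * B c) w"

lemma alternalI:
  assumes "A [] = 0" "\<And>us vs. us \<noteq> [] \<Longrightarrow> vs \<noteq> [] \<Longrightarrow> shuffle_sum A us vs = 0"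
  shows "alternal A"
  unfolding alternal_def
proof (intro allI)
  fix us vs
  show "shuffle_sum A us vs = (if vs = [] then A us else 0) + (if us = [] then A vs else 0)"
    using assms by (cases "us = []"; cases "vs = []") simp_all
qed

lemma insertion_zero:
  assumes "\<And>w. w \<noteq> [] \<Longrightarrow> G w = 0"
  shows "insertion f G w = 0"
  by (simp add: insertion_def insert_after_def insert_before_def assms)

text \<open>
  The sum over shuffles of \<open>us\<close> and \<open>vs\<close> is, after cancellation of the cross terms, a sum of
  insertions into functions \<open>w \<mapsto> shuffle_sum G w vs\<close>. These vanish on nonempty lists, and
  an insertion evaluates its second argument only at nonempty lists, because the letter \<open>y\<close> remains.
\<close>

lemma alternal_insertion:
  assumes "\<And>y. alternal (\<lambda>b. f (y # b))" "alternal G"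
  shows "alternal (insertion f G)"
proof (rule alternalI)
  fix us vs :: "'a list"
  assume ne: "us \<noteq> []" "vs \<noteq> []"
  have z: "shuffle_sum G w vs = 0" "shuffle_sum G w us = 0" if "w \<noteq> []" for w
    using assms(2) ne that by (simp_all add: alternal_def)
  have "shuffle_sum (insertion f G) us vs =
    insertion f (\<lambda>u. shuffle_sum G u vs) us + insertion f (\<lambda>v. shuffle_sum G v us) vs"
    by (simp add: insertion_def[abs_def] shuffle_sum_diff shuffle_sum_insert_after[OF assms(1)]
        shuffle_sum_insert_before[OF assms(1)])
  also have "\<dots> = 0" by (simp add: insertion_zero z)
  finally show "shuffle_sum (insertion f G) us vs = 0" .
qed (simp add: insertion_def insert_after_def insert_before_def)

lemma alternal_add: "alternal A \<Longrightarrow> alternal B \<Longrightarrow> alternal (\<lambda>w. A w + B w)"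
  by (simp add: alternal_def shuffle_sum_add)

lemma alternal_diff: "alternal A \<Longrightarrow> alternal B \<Longrightarrow> alternal (\<lambda>w. A w - B w)"
  by (simp add: alternal_def shuffle_sum_diff)

text \<open>
  On shuffles of \<open>us\<close> and \<open>vs\<close> the product of alternal \<open>A\<close> and \<open>B\<close> gives
  \<open>A us * B vs + A vs * B us\<close>, which is symmetric in \<open>A\<close> and \<open>B\<close>.
\<close>

lemma alternal_commutator:
  assumes "alternal A" "alternal B"
  shows "alternal (\<lambda>w. concat_product A B w - concat_product B A w)"
proof (rule alternalI)
  have *: "shuffle_sum (concat_product A B) us vs = A us * B vs + A vs * B us"
    if "alternal A" "alternal B" "us \<noteq> []" "vs \<noteq> []" for A B :: "'a list \<Rightarrow> rat" and us vs
  proof -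
    have m: "A b * (if c = [] then x else 0) = (if c = [] then A b * x else 0)" for b c x
      by simp
    show ?thesis
      using that(2-4)
      by (simp add: concat_product_def[abs_def] shuffle_sum_split_left_alternal[OF that(1)]
          alternal_def m split_sum_right_Nil)
  qed
  fix us vs :: "'a list"
  assume "us \<noteq> []" "vs \<noteq> []"
  then show "shuffle_sum (\<lambda>w. concat_product A B w - concat_product B A w) us vs = 0"
    by (simp add: shuffle_sum_diff * assms)
qed (simp add: concat_product_def)

lemma shuffle_sum_snoc:
  "shuffle_sum h [y] (vs @ [x]) = shuffle_sum (\<lambda>z. h (z @ [x])) [y] vs + h (vs @ [x, y])"
  by (induction vs arbitrary: h) simp_all

text \<open>
  Consider the relation for inserting \<open>y\<close> into \<open>v # vs\<close> at base point \<open>x\<close>, and the one for inserting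
  \<open>y\<close> into \<open>vs @ [x]\<close> at base point \<open>v\<close>. Moving \<open>x\<close> to the end with a sign matches all terms of
  the two relations with opposite signs, except the term in which \<open>y\<close> lies between \<open>x\<close> and \<open>v\<close>:
  it needs two moves, so that it survives twice.
\<close>

lemma anticyclic_alternal_zero:
  assumes "\<And>x w. f (x # w) = - f (w @ [x])" "\<And>y. alternal (\<lambda>b. f (y # b))"
  shows "f (x # y # v # vs) = 0"
proof -
  have 1: "shuffle_sum (\<lambda>z. f (x # z)) [y] (v # vs) = 0"
    using assms(2)[of x] by (simp add: alternal_def)
  have 2: "shuffle_sum (\<lambda>z. f (v # z)) [y] (vs @ [x]) = 0"
    using assms(2)[of v] by (simp add: alternal_def)
  have 3: "shuffle_sum (\<lambda>z. f (x # v # z)) [y] vs = - shuffle_sum (\<lambda>z. f (v # z @ [x])) [y] vs"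
    using shuffle_sum_mult[of "-1"] assms(1)[of x "v # _"] by simp
  have "f (x # y # v # vs) = f (v # vs @ [x, y])"
    using assms(1)[of x] assms(1)[of y] by simp
  with 1 2 3 show ?thesis by (simp add: shuffle_sum_snoc)
qed

section \<open>Words as monomials\<close>

text \<open>
  A word in the letters \<open>y\<close> as a monomial with one variable for each letter; a word whose
  length is not the number of variables counts as 0. The letter \<open>Y k\<close> stands for \<open>y\<close> with index \<open>k + 1\<close>
  and gives the exponent \<open>k\<close>.
\<close>

fun y_monomial :: "rat list \<Rightarrow> y_letter list \<Rightarrow> rat" where
  "y_monomial [] [] = 1"
| "y_monomial (v # vs) (Y k # ks) = v ^ k * y_monomial vs ks"
| "y_monomial _ _ = 0"

text \<open>
  The word \<open>e0^a0 e1 e0^a1 ... e1 e0^ar\<close> evaluated as \<open>x0^a0 x1^a1 ... xr^ar\<close>; words with another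
  number of letters \<open>e1\<close> count as 0.
\<close>

fun monomial :: "rat list \<Rightarrow> letter list \<Rightarrow> rat" where
  "monomial [] w = 0"
| "monomial (x # xs) [] = (if xs = [] then 1 else 0)"
| "monomial (x # xs) (E0 # w) = x * monomial (x # xs) w"
| "monomial (x # xs) (E1 # w) = monomial xs w"

definition poly_fun :: "letter free_alg \<Rightarrow> rat list \<Rightarrow> rat" where
  "poly_fun \<phi> xs = pairing (monomial xs) \<phi>"

lemma y_monomial_Nil: "y_monomial [] ks = (if ks = [] then 1 else 0)"
  by (cases ks) simp_all

text \<open>
  Multiplying monomials in separate sets of variables and distributing the letters of a word over two words
  is the same as shuffling the lists of variables: the first letter uses the first variable of one of the lists.
\<close>

lemma pairing_y_coproduct_word:
  "pairing (\<lambda>(k, l). y_monomial us k * y_monomial vs l) (coproduct_word ks) =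
     shuffle_sum (\<lambda>w. y_monomial w ks) us vs"
proof (induction ks arbitrary: us vs)
  case Nil
  show ?case
    by (induction us vs rule: shuffle_induct) (simp_all add: coproduct_word_Nil shuffle_sum_mult[of 0, simplified])
next
  case (Cons y ks)
  obtain k where y: "y = Y k" by (cases y)
  have *: "pairing (\<lambda>p. c * y_monomial us (fst p) * y_monomial vs (snd p)) (coproduct_word ks) =
      c * shuffle_sum (\<lambda>w. y_monomial w ks) us vs" for c us vs
    using Cons.IH[of us vs] by (simp add: case_prod_unfold mult.assoc pairing_mult_fun)
  have **: "pairing (\<lambda>p. y_monomial us (fst p) * (c * y_monomial vs (snd p))) (coproduct_word ks) =
      c * shuffle_sum (\<lambda>w. y_monomial w ks) us vs" for c us vs
    using *[of c us vs] by (simp add: ac_simps)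
  show ?case
  proof (cases us)
    case Nil
    then show ?thesis using **[of "[]"]
      by (cases vs) (simp_all add: pairing_coproduct_Cons y case_prod_unfold pairing_add_fun)
  next
    case (Cons u us')
    then show ?thesis using **[of us] *[of _ us' vs]
      by (cases vs) (simp_all add: pairing_coproduct_Cons y case_prod_unfold pairing_add_fun shuffle_sum_mult)
  qed
qed

lemma pairing_y_coproduct:
  "pairing (\<lambda>(k, l). y_monomial us k * y_monomial vs l) (coproduct A) =
     shuffle_sum (\<lambda>w. pairing (y_monomial w) A) us vs"
  by (induction A rule: word_induct)
    (simp_all add: coproduct_add coproduct_smul shuffle_sum_add shuffle_sum_mult,
     simp add: coproduct_def pairing_y_coproduct_word)

lemma pairing_y_tensor_one:
  "pairing (\<lambda>(k, l). y_monomial us k * y_monomial vs l) (tensor A 1 + tensor 1 A) =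
   (if vs = [] then pairing (y_monomial us) A else 0) + (if us = [] then pairing (y_monomial vs) A else 0)"
proof -
  have 1: "y_monomial vs [] = (if vs = [] then 1 else 0)" for vs by (cases vs) simp_all
  show ?thesis unfolding pairing_tensor_one
    by (simp add: 1 pairing_add_fun)
qed

text \<open>
  The finite set of exponents replaces a degree bound, as needed for the next lemma.
\<close>

lemma polynomial_coeffs_zero:
  assumes "finite J" "\<And>u :: rat. (\<Sum>j\<in>J. c j * u ^ j) = 0" "j \<in> J"
  shows "c j = 0"
proof -
  define p where "p = (\<Sum>j\<in>J. monom (c j) j)"
  have "poly p u = poly 0 u" for u
    using assms(2)[of u] by (simp add: p_def poly_sum poly_monom)
  then have "p = 0" using poly_eq_poly_eq_iff[of p 0] by auto
  then have "coeff p j = 0" by simp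
  then show ?thesis using assms(1,3) by (simp add: p_def coeff_sum coeff_monom sum.delta)
qed

text \<open>
  Induction on the word: for fixed values of the other variables the sum is a polynomial in
  the first variable, whose coefficients collect the words with the same first letter.
\<close>

lemma y_monomials_independent:
  fixes c :: "y_letter list \<Rightarrow> rat"
  assumes "finite S" "\<And>us. (\<Sum>k\<in>S. c k * y_monomial us k) = 0" "k \<in> S"
  shows "c k = 0"
  using assms
proof (induction k arbitrary: S c)
  case Nil
  have "(\<Sum>k\<in>S. c k * y_monomial [] k) = c []"
    using Nil.prems(1,3) by (simp add: y_monomial_Nil if_distrib[where f = "(*) _"] sum.delta cong: if_cong)
  then show ?case using Nil.prems(2)[of "[]"] by simp
next
  case (Cons y k)
  obtain j where y: "y = Y j" by (cases y)
  define T where "T = {l. Y j # l \<in> S}"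
  have fT: "finite T"
    using finite_vimageI[OF Cons.prems(1), of "(#) (Y j)"] by (simp add: T_def vimage_def inj_on_def)
  have "(\<Sum>l\<in>T. c (Y j # l) * y_monomial us l) = 0" for us
  proof -
    \<comment> \<open>The coefficient of \<open>u ^ i\<close> is the sum of \<open>d k\<close> over the words with \<open>head k = i\<close>.\<close>
    define head where "head k = (case k of [] \<Rightarrow> 0 | Y i # l \<Rightarrow> i)" for k
    define d where "d k = (case k of [] \<Rightarrow> 0 | Y i # l \<Rightarrow> c k * y_monomial us l)" for k
    have e: "c k * y_monomial (u # us) k = d k * u ^ head k" for k u
    proof (cases k)
      case (Cons y l)
      then show ?thesis by (cases y) (simp add: d_def head_def)
    qed (simp add: d_def)
    have "(\<Sum>i\<in>head ` S. (\<Sum>k\<in>{k\<in>S. head k = i}. d k) * u ^ i) = 0" for u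
    proof -
      have "(\<Sum>i\<in>head ` S. (\<Sum>k\<in>{k\<in>S. head k = i}. d k) * u ^ i) =
          (\<Sum>i\<in>head ` S. \<Sum>k\<in>{k\<in>S. head k = i}. d k * u ^ head k)"
        by (simp add: sum_distrib_right)
      also have "\<dots> = (\<Sum>k\<in>S. d k * u ^ head k)"
        by (rule sum.image_gen[symmetric, OF Cons.prems(1)])
      finally show ?thesis using Cons.prems(2)[of "u # us"] by (simp add: e)
    qed
    moreover have "j \<in> head ` S"
      using Cons.prems(3) y by (force simp: head_def)
    ultimately have "(\<Sum>k\<in>{k\<in>S. head k = j}. d k) = 0"
      using polynomial_coeffs_zero[of "head ` S" "\<lambda>i. \<Sum>k\<in>{k\<in>S. head k = i}. d k"] Cons.prems(1) by blast
    moreover have "(\<Sum>k\<in>{k\<in>S. head k = j}. d k) = (\<Sum>k\<in>(#) (Y j) ` T. d k)"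
      using Cons.prems(1)
      by (intro sum.mono_neutral_right)
        (auto simp: T_def head_def d_def image_iff split: list.splits y_letter.splits)
    moreover have "(\<Sum>k\<in>(#) (Y j) ` T. d k) = (\<Sum>l\<in>T. c (Y j # l) * y_monomial us l)"
      by (subst sum.reindex) (auto simp: inj_on_def d_def)
    ultimately show ?thesis by simp
  qed
  from Cons.IH[OF fT this] show ?case using Cons.prems(3) by (simp add: T_def y)
qed

text \<open>
  Products of monomials in separate variables are independent: the previous lemma is applied first to the left
  and then to the right tensor factors. Hence an identity in the tensor square may be checked on functions.
\<close>

lemma y_pairing_zero:
  fixes X :: "y_letter free_alg2"
  assumes "\<And>us vs. pairing (\<lambda>(k, l). y_monomial us k * y_monomial vs l) X = 0"
  shows "X = 0"
proof (rule poly_mapping_eqI)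
  fix p :: "y_letter list \<times> y_letter list"
  obtain k l where p: "p = (k, l)" by fastforce
  define K where "K = insert k (fst ` Poly_Mapping.keys X)"
  define L where "L = insert l (snd ` Poly_Mapping.keys X)"
  have fin: "finite K" "finite L" by (simp_all add: K_def L_def)
  have "Poly_Mapping.keys X \<subseteq> K \<times> L" by (force simp: K_def L_def)
  then have "0 = (\<Sum>w\<in>K \<times> L. Poly_Mapping.lookup X w * (case w of (k, l) \<Rightarrow> y_monomial us k * y_monomial vs l))" for us vs
    using assms[of us vs] fin by (simp add: pairing_superset[of "K \<times> L"])
  also have "(\<Sum>w\<in>K \<times> L. Poly_Mapping.lookup X w * (case w of (k, l) \<Rightarrow> y_monomial us k * y_monomial vs l)) =
      (\<Sum>k\<in>K. (\<Sum>l\<in>L. Poly_Mapping.lookup X (k, l) * y_monomial vs l) * y_monomial us k)" for us vs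
    unfolding sum_distrib_right sum.cartesian_product by (intro sum.cong) auto
  finally have "(\<Sum>k\<in>K. (\<Sum>l\<in>L. Poly_Mapping.lookup X (k, l) * y_monomial vs l) * y_monomial us k) = 0" for us vs
    by simp
  from y_monomials_independent[OF fin(1) this, of k]
  have "(\<Sum>l\<in>L. Poly_Mapping.lookup X (k, l) * y_monomial vs l) = 0" for vs by (simp add: K_def)
  from y_monomials_independent[OF fin(2) this, of l] show "Poly_Mapping.lookup X p = Poly_Mapping.lookup 0 p"
    by (simp add: L_def p)
qed

lemma primitive_iff_alternal:
  "primitive A \<longleftrightarrow> alternal (\<lambda>vs. pairing (y_monomial vs) A)"
proof
  assume "primitive A"
  then show "alternal (\<lambda>vs. pairing (y_monomial vs) A)"
    unfolding alternal_def
    by (simp add: primitive_def pairing_y_tensor_one flip: pairing_y_coproduct del: pairing_add)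
next
  assume alt: "alternal (\<lambda>vs. pairing (y_monomial vs) A)"
  have "coproduct A - (tensor A 1 + tensor 1 A) = 0"
  proof (rule y_pairing_zero)
    fix us vs
    show "pairing (\<lambda>(k, l). y_monomial us k * y_monomial vs l)
        (coproduct A - (tensor A 1 + tensor 1 A)) = 0"
      unfolding pairing_diff pairing_y_coproduct pairing_y_tensor_one
      using alt by (simp add: alternal_def)
  qed
  then show "primitive A" by (simp add: primitive_def)
qed

text \<open>
  A word beginning with \<open>e1\<close> does not involve the first variable.
\<close>

lemma monomial_y_blocks:
  "monomial (x # vs) (concat (map y_block ks)) = y_monomial vs (map Y ks)"
proof (induction ks arbitrary: x vs)
  case Nil
  show ?case by (cases vs) simp_all
next
  case (Cons k ks)
  have "monomial (x # vs) (replicate n E0 @ w) = x ^ n * monomial (x # vs) w" for x vs n w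
    by (induction n) simp_all
  then show ?case by (cases vs) (simp_all add: y_block_def[of k] Cons.IH)
qed

text \<open>
  Setting the first variable to 0 annihilates the words that begin with \<open>e0\<close>, as \<open>alpha\<close> does.
\<close>

lemma pairing_alpha: "pairing (y_monomial vs) (alpha \<phi>) = poly_fun \<phi> (0 # vs)"
proof -
  have "pairing (y_monomial vs) (alpha_word w) = monomial (0 # vs) w" for w
    by (cases w rule: y_blocks_cases) (simp_all add: monomial_y_blocks)
  then show ?thesis by (simp add: alpha_def pairing_lin_ext poly_fun_def)
qed

lemma primitive_alpha_iff: "primitive (alpha \<phi>) \<longleftrightarrow> alternal (\<lambda>vs. poly_fun \<phi> (0 # vs))"
  by (simp add: primitive_iff_alternal pairing_alpha)

section \<open>Translation invariance\<close>

text \<open>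
  The character of the free algebra with \<open>e0 \<mapsto> t\<close> and \<open>e1 \<mapsto> 0\<close>.
\<close>

fun e0_power :: "rat \<Rightarrow> letter list \<Rightarrow> rat" where
  "e0_power t [] = 1"
| "e0_power t (E0 # w) = t * e0_power t w"
| "e0_power t (E1 # w) = 0"

text \<open>
  Applying this character to the right factor of the coproduct is the algebra endomorphism with
  \<open>e0 \<mapsto> e0 + t\<close> and \<open>e1 \<mapsto> e1\<close>, which translates all variables by \<open>t\<close>.
\<close>

lemma monomial_translate:
  "pairing (\<lambda>(u, v). monomial xs u * e0_power t v) (coproduct_word w) = monomial (map ((+) t) xs) w"
proof (induction w arbitrary: xs)
  case Nil
  show ?case by (cases xs) (simp_all add: coproduct_word_Nil)
next
  case (Cons a w)
  have 1: "pairing (\<lambda>p. c * monomial xs (fst p) * e0_power t (snd p)) (coproduct_word w) =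
      c * monomial (map ((+) t) xs) w" for c xs
    using Cons.IH[of xs] by (simp add: case_prod_unfold mult.assoc pairing_mult_fun)
  have 2: "pairing (\<lambda>p. monomial xs (fst p) * (c * e0_power t (snd p))) (coproduct_word w) =
      c * monomial (map ((+) t) xs) w" for c xs
    using 1[of c xs] by (simp add: ac_simps)
  show ?case
    using 1[of 1 "tl xs"]
    by (cases xs; cases a)
      (simp_all add: pairing_coproduct_Cons case_prod_unfold pairing_add_fun 1 2 distrib_right)
qed

lemma e0_power_zero: "count_list w E1 > 0 \<Longrightarrow> e0_power t w = 0"
  by (induction t w rule: e0_power.induct) simp_all

text \<open>
  The endomorphism \<open>e0 \<mapsto> e0 + t\<close> changes a primitive element only by a constant, the value of the
  character, which is 0 in positive depth.
\<close>

lemma poly_fun_translate: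
  assumes "primitive \<phi>" "bihomogeneous N r \<phi>" "r \<ge> 1"
  shows "poly_fun \<phi> (map ((+) t) xs) = poly_fun \<phi> xs"
proof -
  have "pairing (\<lambda>u. monomial xs [] * e0_power t u) \<phi> = pairing (\<lambda>u. 0) \<phi>"
    using assms(2,3) by (intro pairing_cong) (auto simp: bihomogeneous_def intro!: e0_power_zero)
  then show ?thesis
    using pairing_primitive[OF assms(1), of "\<lambda>(u, v). monomial xs u * e0_power t v"]
    by (simp add: monomial_translate poly_fun_def pairing_add_fun)
qed

lemma shuffle_sum_map:
  "shuffle_sum (\<lambda>w. h (map g w)) us vs = shuffle_sum h (map g us) (map g vs)"
proof (induction us vs arbitrary: h rule: shuffle_induct)
  case (Cons u us v vs)
  show ?case
    using Cons.IH(1)[of "\<lambda>w. h (g u # w)"] Cons.IH(2)[of "\<lambda>w. h (g v # w)"] by simp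
qed simp_all

lemma alternal_poly_fun:
  assumes "primitive \<phi>" "bihomogeneous N r \<phi>" "r \<ge> 1" "primitive (alpha \<phi>)"
  shows "alternal (\<lambda>vs. poly_fun \<phi> (x # vs))"
proof -
  have "poly_fun \<phi> (x # vs) = poly_fun \<phi> (0 # map ((+) (- x)) vs)" for vs
    using poly_fun_translate[OF assms(1-3), of "- x" "x # vs"] by simp
  then show ?thesis
    using assms(4) unfolding primitive_alpha_iff
    by (simp add: alternal_def shuffle_sum_map[of "\<lambda>w. poly_fun \<phi> (0 # w)"])
qed

section \<open>Cyclic invariance\<close>

lemma monomial_Nil: "monomial xs [] = (if length xs = 1 then 1 else 0)"
  by (cases xs) auto

lemma monomial_snoc_E0: "monomial (xs @ [x]) (w @ [E0]) = x * monomial (xs @ [x]) w"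
proof (induction w arbitrary: xs)
  case Nil then show ?case by (cases xs) simp_all
next
  case (Cons a w)
  show ?case using Cons.IH[of xs] Cons.IH[of "tl xs"] by (cases xs; cases a) simp_all
qed

lemma monomial_snoc_E1: "monomial (xs @ [x]) (w @ [E1]) = monomial xs w"
proof (induction w arbitrary: xs)
  case Nil then show ?case by (cases xs) (simp_all add: monomial_Nil)
next
  case (Cons a w)
  show ?case using Cons.IH[of xs] Cons.IH[of "tl xs"] by (cases xs; cases a) simp_all
qed

lemma monomial_rev: "monomial (rev xs) (rev w) = monomial xs w"
proof (induction w arbitrary: xs)
  case Nil
  show ?case by (simp add: monomial_Nil)
next
  case (Cons a w)
  show ?case using Cons.IH[of xs] Cons.IH[of "tl xs"]
    by (cases xs; cases a) (simp_all add: monomial_snoc_E0 monomial_snoc_E1)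
qed

lemma y_monomial_Nil2: "y_monomial vs [] = (if vs = [] then 1 else 0)"
  by (cases vs) simp_all

lemma y_monomial_snoc: "y_monomial (us @ [v]) (js @ [Y k]) = y_monomial us js * v ^ k"
proof (induction us arbitrary: js)
  case Nil
  show ?case
  proof (cases js)
    case (Cons j js')
    then show ?thesis by (cases j) (simp add: y_monomial_Nil)
  qed simp
next
  case (Cons u us)
  show ?case
  proof (cases js)
    case (Cons j js')
    then show ?thesis by (cases j) (simp add: Cons.IH)
  qed (simp add: y_monomial_Nil2)
qed

lemma y_monomial_length: "length vs \<noteq> length ks \<Longrightarrow> y_monomial vs ks = 0"
  by (induction vs ks rule: y_monomial.induct) auto

lemma y_monomial_rev: "y_monomial (rev vs) (rev ks) = y_monomial vs ks"
proof (cases "length vs = length ks")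
  case True
  then show ?thesis
  proof (induction vs ks rule: list_induct2)
    case (Cons v vs k ks)
    then show ?case by (cases k) (simp add: y_monomial_snoc)
  qed simp
qed (simp add: y_monomial_length)

lemma monomial_length: "length xs \<noteq> Suc (count_list w E1) \<Longrightarrow> monomial xs w = 0"
  by (induction xs w rule: monomial.induct) auto

lemma poly_fun_length:
  assumes "bihomogeneous N r \<phi>" "length xs \<noteq> Suc r"
  shows "poly_fun \<phi> xs = 0"
proof -
  have "poly_fun \<phi> xs = pairing (\<lambda>w. 0) \<phi>"
    unfolding poly_fun_def
    using assms by (intro pairing_cong) (auto simp: bihomogeneous_def intro!: monomial_length)
  then show ?thesis by simp
qed

text \<open>
  Reversing a word reverses the exponents of its monomial.
\<close>

lemma poly_fun_rev:
  assumes "primitive \<phi>" "bihomogeneous N r \<phi>"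
  shows "poly_fun \<phi> xs = - ((-1) ^ N * poly_fun \<phi> (rev xs))"
proof -
  have "pairing (\<lambda>w. (-1) ^ length w * monomial xs (rev w)) \<phi> =
      pairing (\<lambda>w. (-1) ^ N * monomial (rev xs) w) \<phi>"
    using assms(2) monomial_rev[of "rev xs"]
    by (intro pairing_cong) (simp add: bihomogeneous_def)
  then show ?thesis
    using primitive_reversal[OF assms(1), of "monomial xs"]
    by (simp add: poly_fun_def pairing_mult_fun)
qed

text \<open>
  The antipode of the algebra on the letters \<open>y\<close> gives the claim at base point 0, and translation
  invariance at every base point.
\<close>

lemma poly_fun_rev_tail:
  assumes "primitive \<phi>" "bihomogeneous N r \<phi>" "r \<ge> 1" "primitive (alpha \<phi>)"
  shows "poly_fun \<phi> (x # vs) = - ((-1) ^ length vs * poly_fun \<phi> (x # rev vs))"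
proof -
  have "poly_fun \<phi> (0 # vs) = - ((-1) ^ length vs * poly_fun \<phi> (0 # rev vs))" for vs
  proof -
    have *: "(-1) ^ length k * y_monomial vs (rev k) = (-1) ^ length vs * y_monomial (rev vs) k" for k
      using y_monomial_rev[of "rev vs" k] y_monomial_length[of vs "rev k"]
      by (cases "length vs = length k") simp_all
    then show ?thesis
      using primitive_reversal[OF assms(4), of "y_monomial vs"]
      by (simp add: pairing_alpha pairing_mult_fun)
  qed
  from this[of "map ((+) (- x)) vs"] show ?thesis
    using poly_fun_translate[OF assms(1-3), of "- x" "x # vs"]
      poly_fun_translate[OF assms(1-3), of "- x" "x # rev vs"]
    by (simp add: rev_map)
qed

text \<open>
  A rotation is the composition of two reversals: that of all variables but the first, and that of
  all variables.
\<close>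

lemma poly_fun_rotate:
  assumes "primitive \<phi>" "bihomogeneous N r \<phi>" "r \<ge> 1" "primitive (alpha \<phi>)"
  shows "poly_fun \<phi> (x # vs) = (-1) ^ (N + r) * poly_fun \<phi> (vs @ [x])"
proof (cases "length vs = r")
  case True
  then show ?thesis
    using poly_fun_rev_tail[OF assms, of x vs] poly_fun_rev[OF assms(1,2), of "x # rev vs"]
    by (simp add: power_add)
qed (simp add: poly_fun_length[OF assms(2)])

text \<open>
  The sign in \<open>poly_fun_rotate\<close> is always harmless: if it is \<open>-1\<close>, then the function vanishes, for
  \<open>r = 1\<close> because the weight is even and for larger \<open>r\<close> by \<open>anticyclic_alternal_zero\<close>.
\<close>

lemma poly_fun_cyclic:
  assumes "bihomogeneous N r \<phi>" "r \<ge> 1" "linearized_double_shuffle N r \<phi>"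
  shows "poly_fun \<phi> (x # vs) = poly_fun \<phi> (vs @ [x])"
proof -
  have prim: "primitive \<phi>" "primitive (alpha \<phi>)"
    using assms(3) by (simp_all add: linearized_double_shuffle_def)
  note rot = poly_fun_rotate[OF prim(1) assms(1,2) prim(2)]
  consider "even (N + r)" | "odd (N + r)" "r = 1" | "odd (N + r)" "r \<ge> 2"
    using assms(2) by linarith
  then show ?thesis
  proof cases
    case 1
    then show ?thesis using rot[of x vs] by simp
  next
    case 2
    then have "\<phi> = 0" using assms(3) by (simp add: linearized_double_shuffle_def)
    then show ?thesis by (simp add: poly_fun_def)
  next
    case 3
    have anti: "poly_fun \<phi> (z # w) = - poly_fun \<phi> (w @ [z])" for z w
      using rot[of z w] 3(1) by simp
    have "poly_fun \<phi> (x # vs) = 0"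
    proof (cases "length vs = r")
      case True
      then obtain y v w where "vs = y # v # w"
        using 3(2) by (metis One_nat_def Suc_1 Suc_le_length_iff)
      then show ?thesis
        using anticyclic_alternal_zero[of "poly_fun \<phi>", OF anti
            alternal_poly_fun[OF prim(1) assms(1,2) prim(2)]] by simp
    qed (simp add: poly_fun_length[OF assms(1)])
    with anti[of x vs] show ?thesis by simp
  qed
qed

section \<open>The Ihara action and the bracket of primitive elements\<close>

text \<open>
  Concatenation multiplies monomials that share one variable: the powers of \<open>e0\<close> at the seam
  merge. Only the cut at the correct number of letters \<open>e1\<close> contributes to the sum.
\<close>

lemma monomial_append:
  "monomial xs (u @ w) = point_sum (\<lambda>b y c. monomial (b @ [y]) u * monomial (y # c) w) xs"
proof (induction u arbitrary: xs)
  case Nil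
  show ?case by (cases xs) (simp_all add: monomial_Nil)
next
  case (Cons a u)
  show ?case
  proof (cases xs)
    case xs: (Cons x xs')
    show ?thesis
      using Cons.IH[of xs] Cons.IH[of xs']
      by (cases a) (simp_all add: xs distrib_left mult.assoc point_sum_mult)
  qed simp
qed

lemma poly_fun_word: "poly_fun (word w) xs = monomial xs w"
  by (simp add: poly_fun_def)

lemma poly_fun_linear:
  "poly_fun (x + y) xs = poly_fun x xs + poly_fun y xs"
  "poly_fun (x - y) xs = poly_fun x xs - poly_fun y xs"
  "poly_fun (smul c x) xs = c * poly_fun x xs"
  by (simp_all add: poly_fun_def)

lemma poly_fun_mult:
  "poly_fun (x * y) xs = point_sum (\<lambda>b z c. poly_fun x (b @ [z]) * poly_fun y (z # c)) xs"
proof (induction x rule: word_induct)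
  case (word u)
  show ?case
    by (induction y rule: word_induct)
      (simp_all add: word_mult plus_list_def poly_fun_word monomial_append smul_mult_right
        poly_fun_linear distrib_left point_sum_add point_sum_mult mult.left_commute[of "monomial _ _"])
qed (simp_all add: poly_fun_linear distrib_right point_sum_add point_sum_mult smul_mult_left mult.assoc)

lemma poly_fun_e0_mult: "poly_fun (e0 * x) (y # xs) = y * poly_fun x (y # xs)"
  by (induction x rule: word_induct)
    (simp_all add: word_mult plus_list_def poly_fun_word smul_mult_right poly_fun_linear distrib_left)

lemma poly_fun_e1_mult: "poly_fun (e1 * x) (y # xs) = poly_fun x xs"
  by (induction x rule: word_induct)
    (simp_all add: word_mult plus_list_def poly_fun_word smul_mult_right poly_fun_linear distrib_left)

lemma circ_word_Nil: "circ_word a [] = word a"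
  using circ_word.simps(1)[of a 0] by simp

lemma circ_word_E0: "circ_word a (E0 # w) = e0 * circ_word a w"
proof (cases w rule: letter_word_cases)
  case (1 n)
  then show ?thesis
    using circ_word.simps(1)[of a n] circ_word.simps(1)[of a "Suc n"] by (simp add: mult.assoc)
next
  case (2 n v)
  then show ?thesis
    using circ_word.simps(2)[of a n v] circ_word.simps(2)[of a "Suc n" v]
    by (simp add: mult.assoc distrib_left)
qed

lemma circ_word_E1:
  "circ_word a (E1 # w) = word a * (e1 * word w) + e1 * (star_word a * word w) + e1 * circ_word a w"
  using circ_word.simps(2)[of a 0 w] by (simp add: mult.assoc)

lemma lin_ext_mult_left: "lin_ext (\<lambda>a. x * f a) y = x * lin_ext f y"
  by (induction y rule: word_induct) (simp_all add: lin_ext_add lin_ext_smul smul_mult_right distrib_left)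

lemma lin_ext_mult_right: "lin_ext (\<lambda>a. f a * x) y = lin_ext f y * x"
  by (induction y rule: word_induct) (simp_all add: lin_ext_add lin_ext_smul smul_mult_left distrib_right)

text \<open>
  The map \<open>a \<mapsto> a*\<close> in the Ihara action is the antipode.
\<close>

lemma primitive_star:
  assumes "primitive f"
  shows "lin_ext star_word f = - f"
proof (rule poly_mapping_eqI)
  fix k :: "letter list"
  let ?b = "\<lambda>w. if w = k then 1 else (0 :: rat)"
  have "pairing ?b (lin_ext star_word f) = pairing (\<lambda>w. (-1) ^ length w * ?b (rev w)) f"
    by (simp add: pairing_lin_ext star_word_def)
  also have "\<dots> = - pairing ?b f" by (rule primitive_reversal[OF assms])
  finally show "Poly_Mapping.lookup (lin_ext star_word f) k = Poly_Mapping.lookup (- f) k"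
    by (simp add: lookup_eq_pairing)
qed

lemma circ_word_right: "circ f (word w) = lin_ext (\<lambda>a. circ_word a w) f"
  by (simp add: circ_def)

lemma circ_Nil: "circ f (word []) = f"
  by (simp add: circ_word_right circ_word_Nil lin_ext_word_self)

lemma circ_E0: "circ f (word (E0 # w)) = e0 * circ f (word w)"
  by (simp add: circ_word_right circ_word_E0 lin_ext_mult_left)

text \<open>
  As the antipode acts on \<open>f\<close> by \<open>-1\<close>, a letter \<open>e1\<close> is replaced by the commutator of \<open>f\<close> and \<open>e1\<close>.
\<close>

lemma circ_E1:
  assumes "primitive f"
  shows "circ f (word (E1 # w)) = f * (e1 * word w) - e1 * (f * word w) + e1 * circ f (word w)"
  by (simp add: circ_word_right circ_word_E1 lin_ext_add_fun lin_ext_mult_left lin_ext_mult_right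
      lin_ext_word_self primitive_star[OF assms])

lemma circ_add_right: "circ f (x + y) = circ f x + circ f y"
  by (simp add: circ_def lin_ext_add lin_ext_add_fun)

lemma circ_smul_right: "circ f (smul c x) = smul c (circ f x)"
  by (simp add: circ_def lin_ext_smul lin_ext_smul_fun)

lemma circ_add_left: "circ (f + g) x = circ f x + circ g x"
  by (simp add: circ_def lin_ext_add)

lemma circ_smul_left: "circ (smul c f) x = smul c (circ f x)"
  by (simp add: circ_def lin_ext_smul)

definition ihara_letter :: "letter free_alg \<Rightarrow> letter \<Rightarrow> letter free_alg" where
  "ihara_letter f a = (if a = E1 then f * e1 - e1 * f else 0)"

lemma circ_eq_derivation:
  assumes "primitive f"
  shows "circ f x = lin_ext (derivation (ihara_letter f)) x + x * f"
proof (induction x rule: word_induct)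
  case (word w)
  have *: "word (a # w) * f = word [a] * (word w * f)" for a :: letter and w
    by (simp add: word_mult plus_list_def flip: mult.assoc)
  show ?case
  proof (induction w)
    case Nil
    have "word [] * f = f" by (simp flip: word_one)
    then show ?case by (simp add: circ_Nil)
  next
    case (Cons a w)
    then show ?case
      by (cases a) (simp_all add: circ_E0 circ_E1[OF assms] ihara_letter_def *[of _ w] algebra_simps)
  qed
qed (simp_all add: circ_add_right circ_smul_right lin_ext_add lin_ext_smul smul_mult_left
      distrib_right free_module.scale_right_distrib)

text \<open>
  The bracket equals \<open>D_f g - D_g f + [g, f]\<close> for the derivations \<open>D_f\<close>, \<open>D_g\<close> of the
  previous lemma.
\<close>

lemma primitive_ihara_bracket:
  assumes "primitive f" "primitive g"
  shows "primitive (ihara_bracket f g)"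
proof -
  have letters: "primitive (ihara_letter h a)" if "primitive h" for h a
    by (simp add: ihara_letter_def primitive_zero primitive_commutator that coproduct_letter)
  have "ihara_bracket f g = lin_ext (derivation (ihara_letter f)) g
      - lin_ext (derivation (ihara_letter g)) f + (g * f - f * g)"
    by (simp add: ihara_bracket_def circ_eq_derivation assms)
  then show ?thesis
    by (simp add: primitive_add primitive_diff primitive_commutator primitive_derivation letters assms)
qed

section \<open>The Ihara action on polynomial functions\<close>

lemma insertion_add: "insertion F (\<lambda>w. G w + H w) xs = insertion F G xs + insertion F H xs"
  by (simp add: insertion_def insert_after_def insert_before_def distrib_left split_sum_add point_sum_add)

lemma insertion_mult: "insertion F (\<lambda>w. c * G w) xs = c * insertion F G xs"
  by (simp add: insertion_def insert_after_def insert_before_def split_sum_mult point_sum_mult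
      mult.left_commute[of _ c] right_diff_distrib)

lemma concat_product_add: "concat_product A (\<lambda>w. G w + H w) xs = concat_product A G xs + concat_product A H xs"
  by (simp add: concat_product_def distrib_left split_sum_add)

lemma concat_product_mult: "concat_product A (\<lambda>w. c * G w) xs = c * concat_product A G xs"
  by (simp add: concat_product_def split_sum_mult mult.left_commute[of _ c])

lemma split_sum_eq_point_sum: "split_sum h xs = h [] xs + point_sum (\<lambda>b y c. h (b @ [y]) c) xs"
  by (induction xs arbitrary: h) simp_all

text \<open>
  Splitting off the first entry \<open>z\<close> of the argument. The product and the subtracted sum collect the terms in
  which no letter remains in front of \<open>y\<close>: in the former \<open>y = z\<close>, in the latter the removed factor
  \<open>b\<close> is everything in front of \<open>y\<close>.
\<close>

lemma insertion_Cons: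
  "insertion F G (z # zs) = concat_product (\<lambda>b. F (z # b)) (\<lambda>c. G (z # c)) zs
     - point_sum (\<lambda>b y c. F (y # b) * G (y # c)) (z # zs) + insertion F (\<lambda>c. G (z # c)) zs"
  by (simp add: insertion_def insert_after_def insert_before_def concat_product_def point_sum_add)

lemma insertion_Nil: "insertion F G [] = 0"
  by (simp add: insertion_def insert_after_def insert_before_def)

text \<open>
  Induction on words in the second argument. The letter \<open>e0\<close> multiplies both sides by the base point
  \<open>x\<close>. For \<open>e1\<close> the base point moves to the first entry of \<open>xs\<close>: the term \<open>f e1 w\<close> yields the
  concatenation product, and \<open>e1 f w\<close> the sum that \<open>insertion_Cons\<close> subtracts, once the cyclic
  invariance of \<open>f\<close> has brought the shared variable to the front.
\<close>

lemma poly_fun_circ: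
  assumes "primitive f" and cyc: "\<And>x w. poly_fun f (x # w) = poly_fun f (w @ [x])"
  shows "poly_fun (circ f g) (x # xs) =
    concat_product (\<lambda>b. poly_fun f (x # b)) (\<lambda>c. poly_fun g (x # c)) xs
    + insertion (poly_fun f) (\<lambda>c. poly_fun g (x # c)) xs"
proof (induction g rule: word_induct)
  case (word w)
  let ?F = "poly_fun f"
  show ?case
  proof (induction w arbitrary: x xs)
    case Nil
    have "insertion ?F (\<lambda>c. if c = [] then 1 else 0) xs = 0"
      by (rule insertion_zero) simp
    moreover have "concat_product (\<lambda>b. ?F (x # b)) (\<lambda>c. if c = [] then 1 else 0) xs = ?F (x # xs)"
      by (simp add: concat_product_def if_distrib[where f = "(*) _"] split_sum_right_Nil cong: if_cong)
    ultimately show ?case by (simp add: circ_Nil poly_fun_word)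
  next
    case (Cons a w)
    show ?case
    proof (cases a)
      case E0
      then show ?thesis
        using Cons.IH[of x xs]
        by (simp add: circ_E0 poly_fun_e0_mult poly_fun_word insertion_mult concat_product_mult distrib_left)
    next
      case E1
      have 1: "poly_fun (f * (e1 * word w)) (x # xs) =
          concat_product (\<lambda>b. ?F (x # b)) (\<lambda>c. poly_fun (word w) c) xs"
        by (simp add: poly_fun_mult[of f] poly_fun_e1_mult concat_product_def
            split_sum_eq_point_sum[of _ xs])
      have 2: "poly_fun (e1 * (f * word w)) (x # xs) =
          point_sum (\<lambda>b y c. ?F (y # b) * poly_fun (word w) (y # c)) xs"
        by (simp add: poly_fun_e1_mult poly_fun_mult[of f] cyc)
      have 3: "poly_fun (e1 * circ f (word w)) (x # xs) =
         insertion ?F (poly_fun (word w)) xs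
         + point_sum (\<lambda>b y c. ?F (y # b) * poly_fun (word w) (y # c)) xs"
      proof (cases xs)
        case Nil
        \<comment> \<open>With the base point as only variable, a product that starts with \<open>e1\<close> evaluates to 0.\<close>
        have "monomial [] = (\<lambda>w. 0)" by (rule ext) simp
        then have "poly_fun y [] = 0" for y by (simp add: poly_fun_def)
        then show ?thesis by (simp add: poly_fun_e1_mult insertion_Nil Nil)
      next
        case (Cons z zs)
        then show ?thesis
          using \<open>poly_fun (circ f (word w)) (z # zs) = _\<close>
          by (simp only: poly_fun_e1_mult insertion_Cons)
      qed
      have "poly_fun (word (E1 # w)) (x # c) = poly_fun (word w) c" for c
        by (simp add: poly_fun_word)
      then show ?thesis
        by (simp add: E1 circ_E1[OF assms(1)] poly_fun_linear 1 2 3)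
    qed
  qed
qed (simp_all add: circ_add_right circ_smul_right poly_fun_linear insertion_add insertion_mult
    concat_product_add concat_product_mult distrib_left)

lemma alternal_ihara_bracket:
  assumes "primitive f" "primitive g"
    and "\<And>x w. poly_fun f (x # w) = poly_fun f (w @ [x])" "\<And>x w. poly_fun g (x # w) = poly_fun g (w @ [x])"
    and alt: "\<And>x. alternal (\<lambda>w. poly_fun f (x # w))" "\<And>x. alternal (\<lambda>w. poly_fun g (x # w))"
  shows "alternal (\<lambda>w. poly_fun (ihara_bracket f g) (x # w))"
proof -
  let ?A = "\<lambda>w. poly_fun f (x # w)" and ?B = "\<lambda>w. poly_fun g (x # w)"
  have "poly_fun (ihara_bracket f g) (x # w) = (concat_product ?A ?B w - concat_product ?B ?A w)
      + (insertion (poly_fun f) ?B w - insertion (poly_fun g) ?A w)" for w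
    by (simp add: ihara_bracket_def poly_fun_linear poly_fun_circ assms(1-4))
  then show ?thesis
    using alternal_add[OF alternal_commutator[OF alt(1) alt(2), of x x]
        alternal_diff[OF alternal_insertion[OF alt(1) alt(2)] alternal_insertion[OF alt(2) alt(1)]], of x x]
    by simp
qed

section \<open>Weight, depth and the span\<close>

lemma bihomogeneous_zero: "bihomogeneous N r 0"
  by (simp add: bihomogeneous_def)

lemma bihomogeneous_add: "bihomogeneous N r x \<Longrightarrow> bihomogeneous N r y \<Longrightarrow> bihomogeneous N r (x + y)"
  using Poly_Mapping.keys_add[of x y] by (auto simp: bihomogeneous_def)

lemma bihomogeneous_smul: "bihomogeneous N r x \<Longrightarrow> bihomogeneous N r (smul c x)"
  by (auto simp: bihomogeneous_def in_keys_iff)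

lemma bihomogeneous_diff: "bihomogeneous N r x \<Longrightarrow> bihomogeneous N r y \<Longrightarrow> bihomogeneous N r (x - y)"
  using Poly_Mapping.keys_diff[of x y] by (auto simp: bihomogeneous_def)

lemma bihomogeneous_word: "bihomogeneous (length w) (count_list w E1) (word w)"
  by (simp add: bihomogeneous_def word_def)

lemma bihomogeneous_mult:
  "bihomogeneous N r x \<Longrightarrow> bihomogeneous M s y \<Longrightarrow> bihomogeneous (N + M) (r + s) (x * y)"
  using keys_mult[of x y] by (fastforce simp: bihomogeneous_def plus_list_def)

lemma bihomogeneous_lin_ext:
  assumes "\<And>w. w \<in> Poly_Mapping.keys x \<Longrightarrow> bihomogeneous N r (f w)"
  shows "bihomogeneous N r (lin_ext f x)"
proof -
  have "bihomogeneous N r (\<Sum>w\<in>A. smul (c w) (f w))" if "finite A" "A \<subseteq> Poly_Mapping.keys x" for A c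
    using that
    by (induction A rule: finite_induct)
      (auto intro: bihomogeneous_zero bihomogeneous_add bihomogeneous_smul assms)
  then show ?thesis by (simp add: lin_ext_def)
qed

lemma bihomogeneous_circ:
  assumes "primitive f" "bihomogeneous N r f" "bihomogeneous M s g"
  shows "bihomogeneous (N + M) (r + s) (circ f g)"
proof -
  have "bihomogeneous (N + length w) (r + count_list w E1) (circ f (word w))" for w
  proof (induction w)
    case Nil
    then show ?case using assms(2) by (simp add: circ_Nil)
  next
    case (Cons a w)
    have e: "bihomogeneous 1 0 e0" "bihomogeneous 1 1 e1"
      using bihomogeneous_word[of "[E0]"] bihomogeneous_word[of "[E1]"] by simp_all
    show ?case
    proof (cases a)
      case E0
      then show ?thesis using bihomogeneous_mult[OF e(1) Cons.IH] by (simp add: circ_E0)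
    next
      case E1
      have "bihomogeneous (Suc (N + length w)) (Suc (r + count_list w E1)) (f * (e1 * word w))"
        using bihomogeneous_mult[OF assms(2) bihomogeneous_mult[OF e(2) bihomogeneous_word[of w]]] by simp
      moreover have "bihomogeneous (Suc (N + length w)) (Suc (r + count_list w E1)) (e1 * (f * word w))"
        using bihomogeneous_mult[OF e(2) bihomogeneous_mult[OF assms(2) bihomogeneous_word[of w]]] by simp
      moreover have "bihomogeneous (Suc (N + length w)) (Suc (r + count_list w E1)) (e1 * circ f (word w))"
        using bihomogeneous_mult[OF e(2) Cons.IH] by simp
      ultimately show ?thesis
        by (simp add: E1 circ_E1[OF assms(1)] bihomogeneous_add bihomogeneous_diff)
    qed
  qed
  moreover have "circ f g = lin_ext (\<lambda>w. circ f (word w)) g"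
    by (induction g rule: word_induct) (simp_all add: circ_add_right circ_smul_right lin_ext_add lin_ext_smul)
  ultimately show ?thesis
    using assms(3) bihomogeneous_lin_ext[of g "N + M" "r + s" "\<lambda>w. circ f (word w)"]
    by (auto simp: bihomogeneous_def)
qed

lemma ihara_bracket_linearized_double_shuffle:
  assumes f: "r \<ge> 1" "bihomogeneous N r f" "linearized_double_shuffle N r f"
    and g: "s \<ge> 1" "bihomogeneous M s g" "linearized_double_shuffle M s g"
  shows "bihomogeneous (N + M) (r + s) (ihara_bracket f g)"
    and "linearized_double_shuffle (N + M) (r + s) (ihara_bracket f g)"
proof -
  have p: "primitive f" "primitive (alpha f)" "primitive g" "primitive (alpha g)"
    using f g by (simp_all add: linearized_double_shuffle_def)
  show "bihomogeneous (N + M) (r + s) (ihara_bracket f g)"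
    using bihomogeneous_circ[OF p(1) f(2) g(2)] bihomogeneous_circ[OF p(3) g(2) f(2)]
    by (simp add: ihara_bracket_def bihomogeneous_diff add.commute)
  have "primitive (alpha (ihara_bracket f g))"
    unfolding primitive_alpha_iff
    using f g p by (intro alternal_ihara_bracket poly_fun_cyclic alternal_poly_fun)
  then show "linearized_double_shuffle (N + M) (r + s) (ihara_bracket f g)"
    using f(1) g(1) p by (simp add: linearized_double_shuffle_def primitive_ihara_bracket)
qed

lemma ihara_bracket_linear:
  "ihara_bracket (x + y) z = ihara_bracket x z + ihara_bracket y z"
  "ihara_bracket z (x + y) = ihara_bracket z x + ihara_bracket z y"
  "ihara_bracket (smul c x) z = smul c (ihara_bracket x z)"
  "ihara_bracket z (smul c x) = smul c (ihara_bracket z x)"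
  by (simp_all add: ihara_bracket_def circ_add_left circ_add_right circ_smul_left circ_smul_right
      free_module.scale_right_diff_distrib)

theorem theorem5p5:
  fixes \<Phi> \<Psi> :: "letter free_alg"
  assumes "\<Phi> \<in> ls" and "\<Psi> \<in> ls"
  shows "ihara_bracket \<Phi> \<Psi> \<in> ls"
proof -
  let ?S = "{\<Phi>. \<exists>N r. r \<ge> 1 \<and> bihomogeneous N r \<Phi> \<and> linearized_double_shuffle N r \<Phi>}"
  have base: "ihara_bracket x y \<in> ls" if "x \<in> ?S" "y \<in> ?S" for x y
  proof -
    from that obtain N r M s where *: "r \<ge> 1" "bihomogeneous N r x" "linearized_double_shuffle N r x"
      "s \<ge> 1" "bihomogeneous M s y" "linearized_double_shuffle M s y" by blast
    have "ihara_bracket x y \<in> ?S"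
      using ihara_bracket_linearized_double_shuffle[OF *] *(1)
      by (intro CollectI exI[of _ "N + M"] exI[of _ "r + s"]) simp
    then show ?thesis unfolding ls_def by (rule free_module.span_base)
  qed
  have zero: "ihara_bracket 0 z = 0" "ihara_bracket z 0 = 0" for z
    using ihara_bracket_linear(1,2)[of 0 0 z] ihara_bracket_linear(2)[of z 0 0] by simp_all
  have sub: "free_module.subspace {x. ihara_bracket x z \<in> ls}"
    "free_module.subspace {x. ihara_bracket z x \<in> ls}" for z
    by (auto simp: free_module.subspace_def ihara_bracket_linear zero ls_def
        intro: free_module.span_zero free_module.span_add free_module.span_scale)
  have "ihara_bracket x \<Psi> \<in> ls" if "x \<in> ?S" for x
    using free_module.span_induct[of \<Psi> ?S "\<lambda>y. ihara_bracket x y \<in> ls"] assms(2) base[OF that] sub(2)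
    by (simp add: ls_def)
  then show ?thesis
    using free_module.span_induct[of \<Phi> ?S "\<lambda>x. ihara_bracket x \<Psi> \<in> ls"] assms(1) sub(1)
    by (simp add: ls_def)
qed

end
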